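(* Let $\mathsf{N}$ be a positive integer and $\mathsf{T},\mathsf{E},\mathsf{A}$ non-negative integers with $\mathsf{N}\ge\mathsf{T}+\mathsf{E}+2\mathsf{A}+1$, and let $\eta\ge0$, $\epsilon>0$. Then for every $\gamma>0$ there exists a secure multiplication coding scheme $\mathcal{C}$ (noise distribution together with a decoding function) that satisfies $\mathsf{T}$-node $\epsilon$-DP and, in the presence of at most $\mathsf{E}$ erasures and at most $\mathsf{A}$ adversarial nodes, achieves $$\mathtt{MSE}(\mathcal{C})\le\frac{\eta^2}{(1+\mathtt{SNR}^* )^2}+\gamma,\qquad \mathtt{SNR}^*=\frac{\eta}{(\sigma^*(\epsilon))^2}.$$
   Context: System model: $\mathsf{N}$ computation nodes jointly estimate $AB$, where $A,B\in\mathbb{R}$ are statistically independent random variables with $\mathbb{E}[A^2]\le\eta$, $\mathbb{E}[B^2]\le\eta$. A coding scheme $\mathcal{C}$ specifies a joint distribution of real random variables $\{\tilde R_i,\tilde S_i\}_{i=1}^{\mathsf{N}}$, independent of $(A,B)$, with zero means, with the family $\{\tilde R_i\}$ independent of the family $\{\tilde S_i\}$, together with a decoding function $d:(\mathbb{R}\cup\{\varepsilon\})^{\mathsf{N}}\to\mathbb{R}$ ($\varepsilon$ is an erasure symbol); $d$ may depend on the noise distribution and on $\mathsf{N},\mathsf{E},\mathsf{A},\eta$. Node $i$ stores $\tilde A_i=A+\tilde R_i$, $\tilde B_i=B+\tilde S_i$ and outputs $\tilde C_i=\tilde A_i\tilde B_i$. For an erased set $\mathcal{E}\subseteq[\mathsf{N}]$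 with $|\mathcal{E}|\le\mathsf{E}$ and adversarial set $\mathcal{A}\subseteq[\mathsf{N}]$ with $|\mathcal{A}|\le\mathsf{A}$, $\mathcal{Y}_{\mathcal{E},\mathcal{A}}$ is the set of vectors $\mathbf{Y}=(Y_1,\dots,Y_{\mathsf{N}})\in(\mathbb{R}\cup\{\varepsilon\})^{\mathsf{N}}$ with $Y_i=\tilde C_i$ for $i\notin\mathcal{E}\cup\mathcal{A}$ and $Y_i=\varepsilon$ for $i\in\mathcal{E}$ (entries for $i\in\mathcal{A}\setminus\mathcal{E}$ are arbitrary reals). The mean square error is $\mathtt{MSE}(\mathcal{C})=\sup_{|\mathcal{E}|\le\mathsf{E},|\mathcal{A}|\le\mathsf{A}}\mathbb{E}\big[\sup_{\mathbf{Y}\in\mathcal{Y}_{\mathcal{E},\mathcal{A}}}(d(\mathbf{Y})-AB)^2\big]$. $\mathsf{T}$-node $\epsilon$-DP: for all $A_0,A_1,B_0,B_1\in\mathbb{R}$ with $|A_0-A_1|\le1$, $|B_0-B_1|\le1$, every $\mathcal{T}=\{t_1,\dots,t_{\mathsf{T}}\}\subseteq[\mathsf{N}]$ and every Borel $\mathcal{B}\subseteq\mathbb{R}^{\mathsf{T}}$, $\mathbb{P}(\mathbf{Y}^{(0)}_{\mathcal{T}}\in\mathcal{B})\le e^{\epsilon}\mathbb{P}(\mathbf{Y}^{(1)}_{\mathcal{T}}\in\mathcal{B})$ and $\mathbb{P}(\mathbf{Z}^{(0)}_{\mathcal{T}}\in\mathcal{B})\le e^{\epsilon}\mathbb{P}(\mathbf{Z}^{(1)}_{\mathcal{T}}\in\mathcal{B})$,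 where $\mathbf{Y}^{(\ell)}_{\mathcal{T}}=(A_\ell+\tilde R_{t_1},\dots,A_\ell+\tilde R_{t_{\mathsf{T}}})$ and $\mathbf{Z}^{(\ell)}_{\mathcal{T}}=(B_\ell+\tilde S_{t_1},\dots,B_\ell+\tilde S_{t_{\mathsf{T}}})$. $(\sigma^*(\epsilon))^2$ is the infimum of $\mathrm{Var}(X)$ over finite-variance real random variables $X$ such that $\mathbb{P}(X'+X\in\mathcal{B})\le e^{\epsilon}\mathbb{P}(X''+X\in\mathcal{B})$ for all reals $|X'-X''|\le1$ and Borel $\mathcal{B}\subseteq\mathbb{R}$; explicitly $(\sigma^*(\epsilon))^2=\frac{2^{2/3}e^{-2\epsilon/3}(1+e^{-2\epsilon/3})+e^{-\epsilon}}{(1-e^{-\epsilon})^2}$. *)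

theory Defs
  imports "HOL-Probability.Probability"
begin

text \<open>Node outputs received by the decoder: an entry is either a real number
  (Some x) or the erasure symbol (None).  Node indices are 0..N-1;
  entries with index at least N are fixed to None.\<close>
type_synonym obs = "nat \<Rightarrow> real option"

definition admissible_outputs ::
  "nat \<Rightarrow> nat set \<Rightarrow> nat set \<Rightarrow> (nat \<Rightarrow> real) \<Rightarrow> obs set" where
  "admissible_outputs N Er Av c =
     {Y. (\<forall>i. N \<le> i \<longrightarrow> Y i = None)
       \<and> (\<forall>i\<in>Er. Y i = None)
       \<and> (\<forall>i<N. i \<notin> Er \<longrightarrow> i \<notin> Av \<longrightarrow> Y i = Some (c i))
       \<and> (\<forall>i<N. i \<in> Av \<longrightarrow> i \<notin> Er \<longrightarrow> Y i \<noteq> None)}"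

text \<open>Expectation of a possibly non-measurable nonnegative function, taken as the
  outer (upper) integral; it coincides with the usual integral for measurable f.\<close>
definition upper_nn_integral :: "'a measure \<Rightarrow> ('a \<Rightarrow> ennreal) \<Rightarrow> ennreal" where
  "upper_nn_integral M f =
     (INF g \<in> {g \<in> borel_measurable M. \<forall>x\<in>space M. f x \<le> g x}. nn_integral M g)"

text \<open>Mean square error of the scheme (noise laws PR, PS of the families R and S,
  decoder d) for given laws muA, muB of the independent inputs A, B.
  The joint law of ((A,B),(R,S)) is the product measure (all independences).\<close>
definition mse ::
  "nat \<Rightarrow> nat \<Rightarrow> nat \<Rightarrow> real measure \<Rightarrow> real measure \<Rightarrow> (nat \<Rightarrow> real) measure
     \<Rightarrow> (nat \<Rightarrow> real) measure \<Rightarrow> (obs \<Rightarrow> real) \<Rightarrow> ennreal" where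
  "mse N E Ad muA muB PR PS d =
     (SUP EA \<in> {(Er, Av). Er \<subseteq> {..<N} \<and> Av \<subseteq> {..<N} \<and> card Er \<le> E \<and> card Av \<le> Ad}.
        upper_nn_integral ((muA \<Otimes>\<^sub>M muB) \<Otimes>\<^sub>M (PR \<Otimes>\<^sub>M PS))
          (\<lambda>((a, b), (r, s)).
             SUP Y \<in> admissible_outputs N (fst EA) (snd EA) (\<lambda>i. (a + r i) * (b + s i)).
               ennreal ((d Y - a * b)\<^sup>2)))"

definition node_dp :: "nat \<Rightarrow> nat \<Rightarrow> real \<Rightarrow> (nat \<Rightarrow> real) measure \<Rightarrow> bool" where
  "node_dp N T \<epsilon> P \<longleftrightarrow>
     (\<forall>x0 x1 :: real. \<bar>x0 - x1\<bar> \<le> 1 \<longrightarrow>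
        (\<forall>TT. TT \<subseteq> {..<N} \<and> card TT = T \<longrightarrow>
           (\<forall>B \<in> sets (PiM TT (\<lambda>_. borel)).
              measure P {r \<in> space P. (\<lambda>i\<in>TT. x0 + r i) \<in> B}
                \<le> exp \<epsilon> * measure P {r \<in> space P. (\<lambda>i\<in>TT. x1 + r i) \<in> B})))"

definition sigma_star_sq :: "real \<Rightarrow> real" where
  "sigma_star_sq \<epsilon> = Inf {(\<integral>x. x\<^sup>2 \<partial>M) - (\<integral>x. x \<partial>M)\<^sup>2 | M :: real measure.
      prob_space M \<and> sets M = sets borel \<and> integrable M (\<lambda>x. x\<^sup>2) \<and>
      (\<forall>x' x''. \<bar>x' - x''\<bar> \<le> 1 \<longrightarrow>
         (\<forall>B \<in> sets borel. measure M {x. x' + x \<in> B} \<le> exp \<epsilon> * measure M {x. x'' + x \<in> B}))}"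

definition noise_law :: "nat \<Rightarrow> (nat \<Rightarrow> real) measure \<Rightarrow> bool" where
  "noise_law N P \<longleftrightarrow> prob_space P \<and> sets P = sets (PiM {..<N} (\<lambda>_. borel)) \<and>
     (\<forall>i<N. integrable P (\<lambda>r. r i) \<and> (\<integral>r. r i \<partial>P) = 0)"

definition input_law :: "real \<Rightarrow> real measure \<Rightarrow> bool" where
  "input_law \<eta> M \<longleftrightarrow> prob_space M \<and> sets M = sets borel \<and>
     integrable M (\<lambda>x. x\<^sup>2) \<and> (\<integral>x. x\<^sup>2 \<partial>M) \<le> \<eta>"

end

theory Submission
  imports Defs "HOL-Computational_Algebra.Polynomial"
begin

text \<open>
  Node \<open>i\<close> adds the value at \<open>x = i\<close> of a random polynomial
  \<open>R (1 \<plusminus> s\<^sup>3 x\<^sup>T) + s\<^sup>2 \<Sum>j=1..<T. Z\<^sub>j x\<^sup>j\<close> to the secret, with a small scale \<open>s\<close>. The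
  noise \<open>R\<close> has nearly the optimal variance at a privacy level slightly better than \<open>\<epsilon>\<close>, and the
  \<open>Z\<^sub>j\<close> are Laplace. For \<open>T\<close> colluding nodes, moving the secret by one is the same as moving
  \<open>R\<close> by at most one and each \<open>Z\<^sub>j\<close> by \<open>O(s)\<close>, which costs at most \<open>\<epsilon>\<close> in total.

  The product of two shares is a polynomial of degree \<open>T\<close> in \<open>x\<close> up to an error \<open>O(s\<^sup>4)\<close>. A best fit
  on all but \<open>Ad\<close> of the surviving nodes agrees with it on \<open>T + 1\<close> honest nodes up to \<open>O(s\<^sup>4)\<close>, hence
  also in its coefficients. The coefficient of \<open>x\<^sup>0\<close> is \<open>(A + R) (B + S)\<close>, that of \<open>x\<^sup>T\<close> is
  \<open>\<plusminus>s\<^sup>3 ((A + R) S + (B + S) R)\<close>, and \<open>A B - (A - k (A + R)) (B - k (B + S))\<close> is a linear combination of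
  \<open>(A + R) (B + S)\<close> and \<open>(A + R) S + (B + S) R\<close>. The mean square error therefore tends to
  the product of two independent linear estimation errors, and the optimal \<open>k\<close> gives the claim.
\<close>

section \<open>Laplace noise and shifts of product measures\<close>

text \<open>The parameter is the rate, so \<open>c\<close> is the privacy loss per unit of
  shift.\<close>

definition laplace :: "real \<Rightarrow> real measure" where
  "laplace c = density lborel (\<lambda>x. ennreal (c / 2 * exp (- c * \<bar>x\<bar>)))"

lemma sets_laplace [simp, measurable_cong]: "sets (laplace c) = sets borel"
  by (simp add: laplace_def)

text \<open>For even \<open>k\<close> the integrand is symmetric, so each half line contributes half
  of the \<open>k\<close>-th moment of the exponential law of rate \<open>c\<close>. The case
  \<open>k = 0\<close> normalises the density and \<open>k = 2\<close> gives a finite second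
  moment.\<close>

lemma nn_integral_laplace_even_power:
  assumes "c > 0" "even k"
  shows "(\<integral>\<^sup>+x. ennreal (x ^ k) \<partial>laplace c) = ennreal (fact k / c ^ k)"
proof -
  have pow: "x ^ k \<ge> 0" for x :: real
    using assms by (simp add: zero_le_even_power)
  have half: "(\<integral>\<^sup>+x. ennreal (1/2) * ennreal (exponential_density c x * x ^ k) \<partial>lborel) = ennreal (fact k / c ^ k / 2)"
    using nn_integral_erlang_ith_moment[of c 0 k] assms
    by (subst nn_integral_cmult) (simp_all add: ennreal_mult'[symmetric] del: ennreal_half)
  have half': "(\<integral>\<^sup>+x. ennreal (1/2) * ennreal (exponential_density c (-x) * x ^ k) \<partial>lborel) = ennreal (fact k / c ^ k / 2)"
    by (subst half[symmetric], subst nn_integral_real_affine[where c="-1" and t=0])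
       (use assms in \<open>simp_all add: power_minus_even\<close>)
  have "(\<integral>\<^sup>+x. ennreal (x ^ k) \<partial>laplace c)
      = (\<integral>\<^sup>+x. ennreal (c / 2 * exp (- c * \<bar>x\<bar>)) * ennreal (x ^ k) \<partial>lborel)"
    unfolding laplace_def by (subst nn_integral_density) simp_all
  also have "\<dots> = (\<integral>\<^sup>+x. ennreal (1/2) * ennreal (exponential_density c x * x ^ k)
      + ennreal (1/2) * ennreal (exponential_density c (-x) * x ^ k) \<partial>lborel)"
  proof (rule nn_integral_cong_AE)
    \<comment> \<open>At \<open>x = 0\<close> both exponential densities are positive, so for
      \<open>k = 0\<close> the splitting into half lines fails at this single point.\<close>
    show "AE x in lborel. ennreal (c / 2 * exp (- c * \<bar>x\<bar>)) * ennreal (x ^ k)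
        = ennreal (1/2) * ennreal (exponential_density c x * x ^ k)
      + ennreal (1/2) * ennreal (exponential_density c (-x) * x ^ k)"
      using AE_lborel_singleton[of "0::real"]
    proof eventually_elim
      case (elim x)
      then show ?case
        using assms pow[of x] by (auto simp: exponential_density_def ennreal_mult'[symmetric] mult_ac simp del: ennreal_half)
    qed
  qed
  also have "\<dots> = ennreal (fact k / c ^ k / 2) + ennreal (fact k / c ^ k / 2)"
    by (subst nn_integral_add) (simp_all add: half half' del: ennreal_half)
  also have "\<dots> = ennreal (fact k / c ^ k)"
    using assms by (subst ennreal_plus[symmetric]) simp_all
  finally show ?thesis .
qed

lemma prob_space_laplace: "c > 0 \<Longrightarrow> prob_space (laplace c)"
  using nn_integral_laplace_even_power[of c 0] by (intro prob_spaceI) simp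

lemma laplace_square_integrable: "c > 0 \<Longrightarrow> integrable (laplace c) (\<lambda>x. x\<^sup>2)"
  using nn_integral_laplace_even_power[of c 2] by (intro integrableI_bounded) simp_all

text \<open>The density is even, so reflecting the integration variable turns the integral into its
  own negative.\<close>

lemma laplace_mean:
  assumes "c > 0"
  shows "(\<integral>x. x \<partial>laplace c) = 0"
proof -
  have eq: "(\<integral>x. x \<partial>laplace c) = (\<integral>x. c / 2 * exp (- c * \<bar>x\<bar>) * x \<partial>lborel)"
    unfolding laplace_def using assms by (subst integral_density) simp_all
  also have "\<dots> = (\<integral>x. c / 2 * exp (- c * \<bar>-x\<bar>) * (-x) \<partial>lborel)"
    by (subst lborel_integral_real_affine[where c="-1" and t=0]) simp_all
  also have "\<dots> = - (\<integral>x. x \<partial>laplace c)"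
    by (simp add: eq)
  finally show ?thesis by simp
qed

text \<open>Translating the integration variable leaves a ratio of two densities, which the triangle
  inequality bounds.\<close>

lemma laplace_shift:
  assumes "c \<ge> 0" and [measurable]: "f \<in> borel_measurable borel"
  shows "(\<integral>\<^sup>+x. f x \<partial>laplace c) \<le> ennreal (exp (c * \<bar>h\<bar>)) * (\<integral>\<^sup>+x. f (h + x) \<partial>laplace c)"
proof -
  have "(\<integral>\<^sup>+x. f x \<partial>laplace c) = (\<integral>\<^sup>+x. ennreal (c / 2 * exp (- c * \<bar>x\<bar>)) * f x \<partial>lborel)"
    unfolding laplace_def by (subst nn_integral_density) simp_all
  also have "\<dots> = (\<integral>\<^sup>+x. ennreal (c / 2 * exp (- c * \<bar>h + x\<bar>)) * f (h + x) \<partial>lborel)"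
    by (subst nn_integral_real_affine[where c=1 and t=h]) simp_all
  also have "\<dots> \<le> (\<integral>\<^sup>+x. ennreal (exp (c * \<bar>h\<bar>)) * (ennreal (c / 2 * exp (- c * \<bar>x\<bar>)) * f (h + x)) \<partial>lborel)"
  proof (intro nn_integral_mono)
    fix x
    have "c * \<bar>x\<bar> \<le> c * (\<bar>h\<bar> + \<bar>h + x\<bar>)"
      using assms by (intro mult_left_mono) auto
    then have "exp (- c * \<bar>h + x\<bar>) \<le> exp (c * \<bar>h\<bar>) * exp (- c * \<bar>x\<bar>)"
      by (simp add: exp_add[symmetric] algebra_simps)
    then have "c / 2 * exp (- c * \<bar>h + x\<bar>) \<le> exp (c * \<bar>h\<bar>) * (c / 2 * exp (- c * \<bar>x\<bar>))"
      using mult_left_mono[of "exp (- c * \<bar>h + x\<bar>)" "exp (c * \<bar>h\<bar>) * exp (- c * \<bar>x\<bar>)" "c/2"] assms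
      by (simp add: mult_ac)
    then show "ennreal (c / 2 * exp (- c * \<bar>h + x\<bar>)) * f (h + x)
      \<le> ennreal (exp (c * \<bar>h\<bar>)) * (ennreal (c / 2 * exp (- c * \<bar>x\<bar>)) * f (h + x))"
      unfolding mult.assoc[symmetric]
      using assms by (intro mult_right_mono) (simp_all add: ennreal_mult'[symmetric] ennreal_leI)
  qed
  also have "\<dots> = ennreal (exp (c * \<bar>h\<bar>)) * (\<integral>\<^sup>+x. f (h + x) \<partial>laplace c)"
    unfolding laplace_def by (subst nn_integral_cmult) (simp_all add: nn_integral_density)
  finally show ?thesis .
qed

text \<open>The density is at least \<open>c / 2 * exp (- c)\<close> on this interval of length 2.
  The bound makes the smoothing argument in \<open>mixture_noise\<close> quantitative.\<close>

lemma laplace_unit_interval: "c > 0 \<Longrightarrow> emeasure (laplace c) {-1..1} \<ge> ennreal (c * exp (- c))"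
proof -
  assume c: "c > 0"
  have "ennreal (c * exp (- c)) = (\<integral>\<^sup>+(x::real). ennreal (c / 2 * exp (- c)) * indicator {-1..1} x \<partial>lborel)"
    using c by (subst nn_integral_cmult_indicator)
      (simp_all add: ennreal_mult'[symmetric] ennreal_numeral[symmetric] del: ennreal_numeral times_divide_eq_left)
  also have "\<dots> \<le> (\<integral>\<^sup>+x. ennreal (c / 2 * exp (- c * \<bar>x\<bar>)) * indicator {-1..1} x \<partial>lborel)"
    using c by (intro nn_integral_mono) (auto split: split_indicator intro!: ennreal_leI)
  also have "\<dots> = emeasure (laplace c) {-1..1}"
    unfolding laplace_def by (subst emeasure_density) simp_all
  finally show ?thesis .
qed

text \<open>Privacy losses multiply over independent coordinates. In the induction step Fubini
  isolates coordinate \<open>j\<close>: the induction hypothesis shifts the inner integral for a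
  fixed value of that coordinate, and the assumption on \<open>M j\<close> is then applied to the
  inner integral as a function of it.\<close>

lemma PiM_shift:
  fixes M :: "'i \<Rightarrow> real measure"
  assumes "\<And>i. prob_space (M i)" and M_borel [simp, measurable_cong]: "\<And>i. sets (M i) = sets borel"
    and "finite I"
    and shift: "\<And>i f. i \<in> I \<Longrightarrow> f \<in> borel_measurable borel \<Longrightarrow>
          (\<integral>\<^sup>+x. f x \<partial>M i) \<le> ennreal (C i) * (\<integral>\<^sup>+x. f (h i + x) \<partial>M i)"
    and C: "\<And>i. i \<in> I \<Longrightarrow> C i \<ge> 0"
    and f: "f \<in> borel_measurable (PiM I (\<lambda>_. borel))"
  shows "(\<integral>\<^sup>+z. f z \<partial>PiM I M) \<le> ennreal (\<Prod>i\<in>I. C i) * (\<integral>\<^sup>+z. f (\<lambda>i\<in>I. h i + z i) \<partial>PiM I M)"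
proof -
  interpret product_sigma_finite M
    using assms(1) by (simp add: product_sigma_finite_def prob_space_imp_sigma_finite)
  show ?thesis
    using \<open>finite I\<close> shift C f
  proof (induction I arbitrary: f rule: finite_induct)
    case empty
    then show ?case by (simp add: PiM_empty nn_integral_count_space_finite restrict_def)
  next
    case (insert j I)
    have [measurable]: "f \<in> borel_measurable (PiM (insert j I) (\<lambda>_. borel))"
      by (fact insert.prems(3))
    have sets_PiM: "sets (PiM J M) = sets (PiM J (\<lambda>_. borel))" for J
      by (rule sets_PiM_cong) simp_all
    note [measurable_cong] = sets_PiM
    have fM: "f \<in> borel_measurable (PiM (insert j I) M)"
      by measurable
    have upd: "(\<lambda>(x, z). z(j := x)) \<in> measurable (borel \<Otimes>\<^sub>M PiM I (\<lambda>_. borel)) (PiM (insert j I) (\<lambda>_. borel))"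
      unfolding split_beta by (rule measurable_fun_upd[where J=I]) auto
    define F where "F = (\<lambda>x z. f ((\<lambda>i\<in>I. h i + z i)(j := x)))"
    have "(\<lambda>(x, z). (x, \<lambda>i\<in>I. h i + z i)) \<in>
       measurable (borel \<Otimes>\<^sub>M PiM I (\<lambda>_. borel)) (borel \<Otimes>\<^sub>M PiM I (\<lambda>_. borel :: real measure))"
      by measurable
    from measurable_compose[OF measurable_compose[OF this upd] insert.prems(3)]
    have F [measurable]: "case_prod F \<in> borel_measurable (borel \<Otimes>\<^sub>M PiM I (\<lambda>_. borel))"
      by (simp add: F_def split_beta)
    interpret finI: finite_product_sigma_finite M I
      by standard (fact insert.hyps)
    have [measurable]: "(\<lambda>x. \<integral>\<^sup>+z. F x z \<partial>PiM I M) \<in> borel_measurable borel"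
      by (rule finI.borel_measurable_nn_integral) measurable
    have F_upd: "f (\<lambda>i\<in>insert j I. h i + (z(j := x)) i) = F (h j + x) z" for x z
      unfolding F_def using insert.hyps by (intro arg_cong[where f=f]) (auto simp: restrict_def fun_eq_iff)
    have fx: "(\<lambda>z. f (z(j := x))) \<in> borel_measurable (PiM I (\<lambda>_. borel))" for x
      using measurable_compose[OF measurable_compose[OF measurable_Pair1' upd] insert.prems(3), of x]
      by simp
    have "(\<integral>\<^sup>+z. f z \<partial>PiM (insert j I) M) = (\<integral>\<^sup>+x. \<integral>\<^sup>+z. f (z(j := x)) \<partial>PiM I M \<partial>M j)"
      by (rule product_nn_integral_insert_rev) (use insert.hyps fM in simp_all)
    also have "\<dots> \<le> (\<integral>\<^sup>+x. ennreal (\<Prod>i\<in>I. C i) * (\<integral>\<^sup>+z. F x z \<partial>PiM I M) \<partial>M j)"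
      unfolding F_def by (intro nn_integral_mono insert.IH fx) (use insert.prems in auto)
    also have "\<dots> = ennreal (\<Prod>i\<in>I. C i) * (\<integral>\<^sup>+x. (\<integral>\<^sup>+z. F x z \<partial>PiM I M) \<partial>M j)"
      by (rule nn_integral_cmult) measurable
    also have "\<dots> \<le> ennreal (\<Prod>i\<in>I. C i) * (ennreal (C j) * (\<integral>\<^sup>+x. (\<integral>\<^sup>+z. F (h j + x) z \<partial>PiM I M) \<partial>M j))"
      by (intro mult_left_mono insert.prems(1)) simp_all
    also have "\<dots> = ennreal (\<Prod>i\<in>insert j I. C i) *
        (\<integral>\<^sup>+x. (\<integral>\<^sup>+z. f (\<lambda>i\<in>insert j I. h i + (z(j := x)) i) \<partial>PiM I M) \<partial>M j)"
      using insert.hyps insert.prems(2)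
      by (simp add: F_upd ennreal_mult prod_nonneg mult_ac del: fun_upd_apply)
    also have "\<dots> = ennreal (\<Prod>i\<in>insert j I. C i) * (\<integral>\<^sup>+z. f (\<lambda>i\<in>insert j I. h i + z i) \<partial>PiM (insert j I) M)"
      by (subst product_nn_integral_insert_rev) (use insert.hyps in simp_all)
    finally show ?case .
  qed
qed

section \<open>Nearly optimal noise with spare privacy budget\<close>

text \<open>Differential privacy of a single real noise with ratio \<open>C\<close>. It is stated
  for integrals of nonnegative functions instead of events so that it can be applied under iterated
  integrals.\<close>

definition shift_bounded :: "real measure \<Rightarrow> real \<Rightarrow> bool" where
  "shift_bounded M C \<longleftrightarrow> (\<forall>h f. \<bar>h\<bar> \<le> 1 \<longrightarrow> f \<in> borel_measurable borel \<longrightarrow>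
     (\<integral>\<^sup>+x. f x \<partial>M) \<le> ennreal C * (\<integral>\<^sup>+x. f (h + x) \<partial>M))"

lemma shift_boundedD:
  "shift_bounded M C \<Longrightarrow> \<bar>h\<bar> \<le> 1 \<Longrightarrow> f \<in> borel_measurable borel \<Longrightarrow>
     (\<integral>\<^sup>+x. f x \<partial>M) \<le> ennreal C * (\<integral>\<^sup>+x. f (h + x) \<partial>M)"
  by (auto simp: shift_bounded_def)

text \<open>One direction tests with translated indicators. For the other, the bound on events says
  that \<open>M\<close> is dominated by \<open>C\<close> times a translate of itself, and the
  integral is monotone in the measure.\<close>

lemma shift_bounded_iff_measure:
  assumes "prob_space M" and [simp, measurable_cong]: "sets M = sets borel" and "C \<ge> 0"
  shows "shift_bounded M C \<longleftrightarrow> (\<forall>x' x''. \<bar>x' - x''\<bar> \<le> 1 \<longrightarrow>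
         (\<forall>B \<in> sets borel. measure M {x. x' + x \<in> B} \<le> C * measure M {x. x'' + x \<in> B}))"
    (is "_ \<longleftrightarrow> ?R")
proof
  interpret prob_space M by fact
  have sp [simp]: "space M = UNIV"
    using sets_eq_imp_space_eq[of M borel] by simp
  have em: "(\<integral>\<^sup>+x. indicator B (t + x) \<partial>M) = ennreal (measure M {x. t + x \<in> B})"
    if [measurable]: "B \<in> sets borel" for B and t :: real
  proof -
    have "(\<integral>\<^sup>+x. indicator B (t + x) \<partial>M) = (\<integral>\<^sup>+x. indicator {x \<in> space M. t + x \<in> B} x \<partial>M)"
      by (intro nn_integral_cong) (auto split: split_indicator)
    also have "\<dots> = emeasure M {x \<in> space M. t + x \<in> B}"
      by (intro nn_integral_indicator) measurable
    finally show ?thesis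
      by (simp add: emeasure_eq_measure)
  qed
  {
    assume sb: "shift_bounded M C"
    show ?R
    proof (intro allI impI ballI)
      fix x' x'' :: real and B :: "real set"
      assume "\<bar>x' - x''\<bar> \<le> 1" and [measurable]: "B \<in> sets borel"
      then have "(\<integral>\<^sup>+x. indicator B (x' + x) \<partial>M) \<le> ennreal C * (\<integral>\<^sup>+x. indicator B (x' + ((x'' - x') + x)) \<partial>M)"
        by (intro shift_boundedD[OF sb]) auto
      then show "measure M {x. x' + x \<in> B} \<le> C * measure M {x. x'' + x \<in> B}"
        using \<open>C \<ge> 0\<close> by (simp add: em add.assoc[symmetric] ennreal_mult'[symmetric])
    qed
  next
    assume R: ?R
    show "shift_bounded M C"
      unfolding shift_bounded_def
    proof (intro allI impI)
      fix h :: real and f :: "real \<Rightarrow> ennreal"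
      assume h: "\<bar>h\<bar> \<le> 1" and [measurable]: "f \<in> borel_measurable borel"
      have "M \<le> scale_measure (ennreal C) (distr M borel (\<lambda>x. h + x))"
      proof (subst le_measure)
        show "\<forall>A\<in>sets M. emeasure M A \<le> emeasure (scale_measure (ennreal C) (distr M borel ((+) h))) A"
        proof
          fix A assume A: "A \<in> sets M"
          then have "measure M {x. 0 + x \<in> A} \<le> C * measure M {x. h + x \<in> A}"
            using R[rule_format, of 0 h A] h by simp
          then show "emeasure M A \<le> emeasure (scale_measure (ennreal C) (distr M borel ((+) h))) A"
            using A \<open>C \<ge> 0\<close>
            by (simp add: emeasure_eq_measure emeasure_distr ennreal_mult'[symmetric] vimage_def ennreal_leI)
        qed
      qed simp
      then have "(\<integral>\<^sup>+x. f x \<partial>M) \<le> (\<integral>\<^sup>+x. f x \<partial>scale_measure (ennreal C) (distr M borel (\<lambda>x. h + x)))"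
        by (intro nn_integral_mono_measure) simp_all
      also have "\<dots> = ennreal C * (\<integral>\<^sup>+x. f (h + x) \<partial>M)"
        by (simp add: nn_integral_scale_measure nn_integral_distr)
      finally show "(\<integral>\<^sup>+x. f x \<partial>M) \<le> ennreal C * (\<integral>\<^sup>+x. f (h + x) \<partial>M)" .
    qed
  }
qed

lemma integrable_of_square_integrable:
  assumes "prob_space M" "sets M = sets borel" "integrable M (\<lambda>x::real. x\<^sup>2)"
  shows "integrable M (\<lambda>x. x)"
proof -
  interpret prob_space M by fact
  note [measurable_cong] = assms(2)
  show ?thesis
    by (rule square_integrable_imp_integrable[OF _ assms(3)]) measurable
qed

text \<open>Subtracting the mean does not affect the shift condition and turns the variance into the
  second moment. Shares must have mean zero, while \<open>sigma_star_sq\<close> ranges over laws of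
  any mean.\<close>

lemma centered_noise:
  assumes "prob_space M" and sets_M [simp, measurable_cong]: "sets M = sets borel"
    and sq: "integrable M (\<lambda>x::real. x\<^sup>2)" and sb: "shift_bounded M C"
  obtains M' where "prob_space M'" "sets M' = sets borel" "integrable M' (\<lambda>x. x\<^sup>2)"
    "(\<integral>x. x \<partial>M') = 0" "(\<integral>x. x\<^sup>2 \<partial>M') = (\<integral>x. x\<^sup>2 \<partial>M) - (\<integral>x. x \<partial>M)\<^sup>2" "shift_bounded M' C"
proof
  interpret prob_space M by fact
  note int = integrable_of_square_integrable[OF assms(1-3)]
  define m where "m = (\<integral>x. x \<partial>M)"
  define M' where "M' = distr M borel (\<lambda>x. x - m)"
  show "prob_space M'"
    unfolding M'_def by (rule prob_space_distr) simp
  show "sets M' = sets borel"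
    by (simp add: M'_def)
  have sq_eq: "(\<lambda>x. (x - m)\<^sup>2) = (\<lambda>x. x\<^sup>2 - 2 * m * x + m\<^sup>2)"
    by (auto simp: fun_eq_iff power2_eq_square algebra_simps)
  have "integrable M (\<lambda>x. (x - m)\<^sup>2)"
    unfolding sq_eq using sq int by simp
  then show "integrable M' (\<lambda>x. x\<^sup>2)"
    unfolding M'_def by (subst integrable_distr_eq) simp_all
  show "(\<integral>x. x \<partial>M') = 0"
  proof -
    have "(\<integral>x. x \<partial>M') = (\<integral>x. x - m \<partial>M)"
      unfolding M'_def by (rule integral_distr) simp_all
    also have "\<dots> = (\<integral>x. x \<partial>M) - (\<integral>x. m \<partial>M)"
      by (rule Bochner_Integration.integral_diff[OF int]) simp
    also have "\<dots> = 0"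
      unfolding m_def[symmetric] by (simp add: prob_space)
    finally show ?thesis .
  qed
  show "(\<integral>x. x\<^sup>2 \<partial>M') = (\<integral>x. x\<^sup>2 \<partial>M) - (\<integral>x. x \<partial>M)\<^sup>2"
  proof -
    have "(\<integral>x. x\<^sup>2 \<partial>M') = (\<integral>x. (x - m)\<^sup>2 \<partial>M)"
      unfolding M'_def by (rule integral_distr) simp_all
    then show ?thesis
      using variance_eq[OF int sq] by (simp add: m_def)
  qed
  show "shift_bounded M' C"
    unfolding shift_bounded_def
  proof (intro allI impI)
    fix h :: real and f :: "real \<Rightarrow> ennreal"
    assume h: "\<bar>h\<bar> \<le> 1" and [measurable]: "f \<in> borel_measurable borel"
    show "(\<integral>\<^sup>+x. f x \<partial>M') \<le> ennreal C * (\<integral>\<^sup>+x. f (h + x) \<partial>M')"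
      using shift_boundedD[OF sb h, of "\<lambda>x. f (x - m)"]
      by (simp add: M'_def nn_integral_distr add_diff_eq)
  qed
qed

text \<open>Mixing in a little of a smoother noise turns a density ratio bound of exactly \<open>exp \<epsilon>\<close>
  into a strictly smaller one. This leaves privacy budget for the auxiliary noises.\<close>
lemma mixture_noise:
  assumes "prob_space M" and sets_M [simp, measurable_cong]: "sets M = sets borel"
    and sq: "integrable M (\<lambda>x::real. x\<^sup>2)" and sb: "shift_bounded M (exp \<epsilon>)" and "\<epsilon> > 0" "\<delta> > 0"
  obtains M' C where "prob_space M'" "sets M' = sets borel" "integrable M' (\<lambda>x. x\<^sup>2)"
    "(\<integral>x. x\<^sup>2 \<partial>M') \<le> (\<integral>x. x\<^sup>2 \<partial>M) + \<delta>" "shift_bounded M' C" "0 < C" "C < exp \<epsilon>"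
proof -
  interpret M: prob_space M by fact
  define L where "L = laplace (\<epsilon> / 2)"
  have [simp, measurable_cong]: "sets L = sets borel"
    by (simp add: L_def)
  interpret L: prob_space L
    unfolding L_def using \<open>\<epsilon> > 0\<close> by (intro prob_space_laplace) simp
  interpret PL: pair_prob_space M L ..
  define V where "V = (\<integral>x. x\<^sup>2 \<partial>M)"
  define W where "W = (\<integral>x. x\<^sup>2 \<partial>L)"
  have VW: "V \<ge> 0" "W \<ge> 0"
    by (simp_all add: V_def W_def)
  \<comment> \<open>The mixture weight. The second moment of the mixture is at most
    \<open>(1 - l) * V + l * (2 * V + 2 * W) = V + l * (V + 2 * W)\<close>, hence at most
    \<open>V + \<delta>\<close>.\<close>
  define l where "l = min (1/2) (\<delta> / (V + 2 * W + 1))"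
  have l: "0 < l" "l \<le> 1/2" "l * (V + 2 * W) \<le> \<delta>"
  proof -
    show "0 < l"
      unfolding l_def using VW \<open>\<delta> > 0\<close> by simp
    show "l \<le> 1/2"
      unfolding l_def by (rule min.cobounded1)
    have "l * (V + 2 * W) \<le> l * (V + 2 * W + 1)"
      using \<open>0 < l\<close> by simp
    also have "\<dots> \<le> \<delta> / (V + 2 * W + 1) * (V + 2 * W + 1)"
      unfolding l_def using VW by (intro mult_right_mono) auto
    finally show "l * (V + 2 * W) \<le> \<delta>"
      using VW by simp
  qed
  \<comment> \<open>The mixture is realised as \<open>x + y\<close> with probability
    \<open>l\<close> and as \<open>x\<close> otherwise, with \<open>x\<close> from \<open>M\<close>
    and \<open>y\<close> from \<open>L\<close>: it combines \<open>M\<close> with its convolution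
    with \<open>L\<close>.\<close>
  define D where "D = M \<Otimes>\<^sub>M (L \<Otimes>\<^sub>M measure_pmf (bernoulli_pmf l))"
  define \<phi> where "\<phi> = (\<lambda>(x, y, b). x + (if b then y else 0) :: real)"
  have \<phi> [measurable]: "\<phi> \<in> borel_measurable D"
    unfolding \<phi>_def D_def by measurable
  interpret D: prob_space D
    unfolding D_def by (intro prob_space_pair M.prob_space_axioms L.prob_space_axioms prob_space_measure_pmf)
  interpret B: prob_space "L \<Otimes>\<^sub>M measure_pmf (bernoulli_pmf l)"
    by (intro prob_space_pair L.prob_space_axioms prob_space_measure_pmf)
  define M' where "M' = distr D borel \<phi>"
  have nn: "(\<integral>\<^sup>+x. f x \<partial>M') = ennreal (1 - l) * (\<integral>\<^sup>+x. f x \<partial>M) + ennreal l * (\<integral>\<^sup>+x. (\<integral>\<^sup>+y. f (x + y) \<partial>L) \<partial>M)"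
    if [measurable]: "f \<in> borel_measurable borel" for f
  proof -
    have f\<phi>: "(\<lambda>p. f (\<phi> p)) \<in> borel_measurable (M \<Otimes>\<^sub>M (L \<Otimes>\<^sub>M measure_pmf (bernoulli_pmf l)))"
      using measurable_compose[OF \<phi>, of f] by (simp add: D_def)
    have f\<phi>x: "(\<lambda>q. f (\<phi> (x, q))) \<in> borel_measurable (L \<Otimes>\<^sub>M measure_pmf (bernoulli_pmf l))" for x
      by (rule measurable_compose[OF measurable_Pair1' f\<phi>]) (simp add: sets_eq_imp_space_eq[OF sets_M])
    have "(\<integral>\<^sup>+x. f x \<partial>M') = (\<integral>\<^sup>+p. f (\<phi> p) \<partial>D)"
      unfolding M'_def by (rule nn_integral_distr) (use \<phi> in simp_all)
    also have "\<dots> = (\<integral>\<^sup>+x. (\<integral>\<^sup>+q. f (\<phi> (x, q)) \<partial>(L \<Otimes>\<^sub>M measure_pmf (bernoulli_pmf l))) \<partial>M)"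
      unfolding D_def by (rule B.nn_integral_fst[OF f\<phi>, symmetric])
    also have "\<dots> = (\<integral>\<^sup>+x. (\<integral>\<^sup>+y. (\<integral>\<^sup>+b. f (\<phi> (x, y, b)) \<partial>measure_pmf (bernoulli_pmf l)) \<partial>L) \<partial>M)"
      by (intro nn_integral_cong measure_pmf.nn_integral_fst[OF f\<phi>x, symmetric])
    also have "\<dots> = (\<integral>\<^sup>+x. (\<integral>\<^sup>+y. ennreal l * f (x + y) + ennreal (1 - l) * f x \<partial>L) \<partial>M)"
      using l by (simp add: \<phi>_def mult.commute)
    also have "\<dots> = (\<integral>\<^sup>+x. ennreal l * (\<integral>\<^sup>+y. f (x + y) \<partial>L) + ennreal (1 - l) * f x \<partial>M)"
      by (simp add: nn_integral_add nn_integral_cmult L.emeasure_space_1)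
    also have "\<dots> = ennreal (1 - l) * (\<integral>\<^sup>+x. f x \<partial>M) + ennreal l * (\<integral>\<^sup>+x. (\<integral>\<^sup>+y. f (x + y) \<partial>L) \<partial>M)"
      by (simp add: nn_integral_add nn_integral_cmult add.commute)
    finally show ?thesis .
  qed
  define c where "c = \<epsilon> / 2 * exp (- (\<epsilon> / 2))"
  have "c > 0"
    using \<open>\<epsilon> > 0\<close> by (simp add: c_def)
  \<comment> \<open>The convolution dominates a multiple of \<open>M\<close> itself: with
    probability at least \<open>c\<close> the Laplace variable lies in \<open>[-1, 1]\<close>, and
    undoing such a shift costs only \<open>exp \<epsilon>\<close>.\<close>
  have smooth: "ennreal c * (\<integral>\<^sup>+x. f x \<partial>M) \<le> ennreal (exp \<epsilon>) * (\<integral>\<^sup>+x. (\<integral>\<^sup>+y. f (x + y) \<partial>L) \<partial>M)"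
    if [measurable]: "f \<in> borel_measurable borel" for f
  proof -
    have "ennreal c * (\<integral>\<^sup>+x. f x \<partial>M) \<le> emeasure L {-1..1} * (\<integral>\<^sup>+x. f x \<partial>M)"
      unfolding c_def L_def using laplace_unit_interval[of "\<epsilon> / 2"] \<open>\<epsilon> > 0\<close> by (intro mult_right_mono) auto
    also have "\<dots> = (\<integral>\<^sup>+y. indicator {-1..1} y * (\<integral>\<^sup>+x. f x \<partial>M) \<partial>L)"
      by (subst nn_integral_multc) simp_all
    also have "\<dots> \<le> (\<integral>\<^sup>+y. ennreal (exp \<epsilon>) * (\<integral>\<^sup>+x. f (x + y) \<partial>M) \<partial>L)"
    proof (intro nn_integral_mono)
      fix y
      show "indicator {-1..1} y * (\<integral>\<^sup>+x. f x \<partial>M) \<le> ennreal (exp \<epsilon>) * (\<integral>\<^sup>+x. f (x + y) \<partial>M)"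
        using shift_boundedD[OF sb, of y f] by (cases "y \<in> {-1..1}") (auto simp: add.commute)
    qed
    also have "\<dots> = ennreal (exp \<epsilon>) * (\<integral>\<^sup>+y. (\<integral>\<^sup>+x. f (x + y) \<partial>M) \<partial>L)"
      by (rule nn_integral_cmult) measurable
    also have "(\<integral>\<^sup>+y. (\<integral>\<^sup>+x. f (x + y) \<partial>M) \<partial>L) = (\<integral>\<^sup>+x. (\<integral>\<^sup>+y. f (x + y) \<partial>L) \<partial>M)"
      by (rule PL.Fubini') measurable
    finally show ?thesis .
  qed
  \<comment> \<open>The convolution part has ratio \<open>exp (\<epsilon> / 2)\<close>, which leaves
    room to enlarge its weight by the factor \<open>1 + \<kappa> = exp (\<epsilon> / 4)\<close>. By
    \<open>smooth\<close>, this extra weight absorbs a fraction \<open>\<theta>\<close> of the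
    contribution of \<open>M\<close>.\<close>
  define \<kappa> where "\<kappa> = exp (\<epsilon> / 4) - 1"
  have "\<kappa> > 0"
    using \<open>\<epsilon> > 0\<close> by (simp add: \<kappa>_def)
  define \<theta> where "\<theta> = min (1/2) (l * \<kappa> * c / exp \<epsilon>)"
  have \<theta>: "0 < \<theta>" "\<theta> \<le> 1/2" "\<theta> * exp \<epsilon> \<le> l * \<kappa> * c"
    unfolding \<theta>_def using l \<open>\<kappa> > 0\<close> \<open>c > 0\<close> by (auto simp: min_def field_simps)
  \<comment> \<open>After the transfer the \<open>M\<close> part is left with ratio
    \<open>(1 - \<theta>) * exp \<epsilon>\<close> and the convolution part with
    \<open>exp (\<epsilon> / 4) * exp (\<epsilon> / 2)\<close>, both strictly below
    \<open>exp \<epsilon>\<close>.\<close>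
  define C where "C = max (exp \<epsilon> * (1 - \<theta>)) (exp (3/4 * \<epsilon>))"
  have C: "0 < C" "C < exp \<epsilon>"
    using \<theta> \<open>\<epsilon> > 0\<close> by (auto simp: C_def less_max_iff_disj)
  have "shift_bounded M' C"
    unfolding shift_bounded_def
  proof (intro allI impI)
    fix h :: real and f :: "real \<Rightarrow> ennreal"
    assume h: "\<bar>h\<bar> \<le> 1" and [measurable]: "f \<in> borel_measurable borel"
    let ?a = "\<integral>\<^sup>+x. f x \<partial>M" and ?b = "\<integral>\<^sup>+x. (\<integral>\<^sup>+y. f (x + y) \<partial>L) \<partial>M"
    let ?a' = "\<integral>\<^sup>+x. f (h + x) \<partial>M" and ?b' = "\<integral>\<^sup>+x. (\<integral>\<^sup>+y. f (h + (x + y)) \<partial>L) \<partial>M"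
    have a: "?a \<le> ennreal (exp \<epsilon>) * ?a'"
      using h by (intro shift_boundedD[OF sb]) auto
    have b: "?b \<le> ennreal (exp (\<epsilon> / 2)) * ?b'"
    proof -
      have "?b \<le> (\<integral>\<^sup>+x. ennreal (exp (\<epsilon> / 2)) * (\<integral>\<^sup>+y. f (h + (x + y)) \<partial>L) \<partial>M)"
      proof (intro nn_integral_mono)
        fix x
        have "(\<integral>\<^sup>+y. f (x + y) \<partial>L) \<le> ennreal (exp (\<epsilon> / 2 * \<bar>h\<bar>)) * (\<integral>\<^sup>+y. f (x + (h + y)) \<partial>L)"
          unfolding L_def using \<open>\<epsilon> > 0\<close> by (intro laplace_shift) simp_all
        also have "\<dots> \<le> ennreal (exp (\<epsilon> / 2)) * (\<integral>\<^sup>+y. f (x + (h + y)) \<partial>L)"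
          using h \<open>\<epsilon> > 0\<close> mult_left_mono[of "\<bar>h\<bar>" 1 "\<epsilon> / 2"] by (intro mult_right_mono ennreal_leI) auto
        finally show "(\<integral>\<^sup>+y. f (x + y) \<partial>L) \<le> ennreal (exp (\<epsilon> / 2)) * (\<integral>\<^sup>+y. f (h + (x + y)) \<partial>L)"
          by (simp add: add.left_commute)
      qed
      also have "\<dots> = ennreal (exp (\<epsilon> / 2)) * ?b'"
        by (rule nn_integral_cmult) measurable
      finally show ?thesis .
    qed
    have \<theta>a: "ennreal \<theta> * ?a \<le> ennreal (l * \<kappa>) * ?b"
    proof -
      have "ennreal \<theta> * ?a = ennreal (\<theta> / c) * (ennreal c * ?a)"
        using \<open>c > 0\<close> \<theta> by (simp add: mult.assoc[symmetric] ennreal_mult'[symmetric])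
      also have "\<dots> \<le> ennreal (\<theta> / c) * (ennreal (exp \<epsilon>) * ?b)"
        by (intro mult_left_mono smooth) simp_all
      also have "\<dots> = ennreal (\<theta> * exp \<epsilon> / c) * ?b"
        using \<open>c > 0\<close> \<theta> by (simp add: mult.assoc[symmetric] ennreal_mult'[symmetric])
      also have "\<dots> \<le> ennreal (l * \<kappa>) * ?b"
        using \<theta> \<open>c > 0\<close> by (intro mult_right_mono ennreal_leI) (simp_all add: field_simps)
      finally show ?thesis .
    qed
    have split1: "ennreal (1 - l) = ennreal ((1 - l) * (1 - \<theta>)) + ennreal (1 - l) * ennreal \<theta>"
    proof -
      have "ennreal (1 - l) = ennreal ((1 - l) * (1 - \<theta>) + (1 - l) * \<theta>)"
        by (simp add: distrib_left[symmetric])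
      also have "\<dots> = ennreal ((1 - l) * (1 - \<theta>)) + ennreal ((1 - l) * \<theta>)"
        using l \<theta> by (intro ennreal_plus mult_nonneg_nonneg) auto
      finally show ?thesis
        using \<theta> by (simp add: ennreal_mult'')
    qed
    have split2: "ennreal (l * exp (\<epsilon> / 4)) = ennreal (l * \<kappa>) + ennreal l"
      using l \<open>\<kappa> > 0\<close> by (subst ennreal_plus[symmetric]) (auto simp: \<kappa>_def algebra_simps)
    have "(\<integral>\<^sup>+x. f x \<partial>M') = ennreal (1 - l) * ?a + ennreal l * ?b"
      by (rule nn) simp
    also have "ennreal (1 - l) * ?a = ennreal ((1 - l) * (1 - \<theta>)) * ?a + ennreal (1 - l) * (ennreal \<theta> * ?a)"
      by (subst split1) (simp add: distrib_right mult.assoc)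
    also have "\<dots> + ennreal l * ?b \<le> ennreal ((1 - l) * (1 - \<theta>)) * (ennreal (exp \<epsilon>) * ?a') + 1 * (ennreal (l * \<kappa>) * ?b) + ennreal l * ?b"
      using l by (intro add_mono[OF add_mono[OF mult_left_mono[OF a] mult_mono[OF _ \<theta>a]] order_refl]) simp_all
    also have "\<dots> = ennreal ((1 - l) * ((1 - \<theta>) * exp \<epsilon>)) * ?a' + ennreal (l * exp (\<epsilon> / 4)) * ?b"
      using l \<theta> by (simp add: split2 distrib_right ennreal_mult' mult.assoc add.assoc)
    also have "\<dots> \<le> ennreal ((1 - l) * ((1 - \<theta>) * exp \<epsilon>)) * ?a' + ennreal (l * exp (\<epsilon> / 4)) * (ennreal (exp (\<epsilon> / 2)) * ?b')"
      by (intro add_left_mono mult_left_mono b) simp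
    also have "\<dots> = ennreal ((1 - \<theta>) * exp \<epsilon>) * (ennreal (1 - l) * ?a') + ennreal (exp (3/4 * \<epsilon>)) * (ennreal l * ?b')"
    proof -
      have "ennreal (l * exp (\<epsilon> / 4)) * ennreal (exp (\<epsilon> / 2)) = ennreal (exp (3/4 * \<epsilon>)) * ennreal l"
        using l by (simp add: ennreal_mult'[symmetric] exp_add[symmetric] mult.assoc mult.commute[of l])
      moreover have "ennreal ((1 - l) * ((1 - \<theta>) * exp \<epsilon>)) = ennreal ((1 - \<theta>) * exp \<epsilon>) * ennreal (1 - l)"
        using l by (simp add: ennreal_mult' mult.commute)
      ultimately show ?thesis
        by (simp add: mult.assoc[symmetric])
    qed
    also have "\<dots> \<le> ennreal C * (ennreal (1 - l) * ?a') + ennreal C * (ennreal l * ?b')"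
      by (intro add_mono mult_right_mono ennreal_leI) (simp_all add: C_def mult.commute)
    also have "\<dots> = ennreal C * (\<integral>\<^sup>+x. f (h + x) \<partial>M')"
      by (subst nn) (simp_all add: distrib_left)
    finally show "(\<integral>\<^sup>+x. f x \<partial>M') \<le> ennreal C * (\<integral>\<^sup>+x. f (h + x) \<partial>M')" .
  qed
  moreover have "(\<integral>\<^sup>+x. ennreal (x\<^sup>2) \<partial>M') \<le> ennreal (V + \<delta>)"
  proof -
    have V: "(\<integral>\<^sup>+x. ennreal (x\<^sup>2) \<partial>M) = ennreal V"
      unfolding V_def by (rule nn_integral_eq_integral[OF sq]) simp
    have W: "(\<integral>\<^sup>+x. ennreal (x\<^sup>2) \<partial>L) = ennreal W"
      unfolding W_def L_def using \<open>\<epsilon> > 0\<close>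
      by (intro nn_integral_eq_integral laplace_square_integrable) simp_all
    have "(\<integral>\<^sup>+y. ennreal ((x + y)\<^sup>2) \<partial>L) \<le> ennreal (2 * x\<^sup>2) + ennreal (2 * W)" for x
    proof -
      have "(x + y)\<^sup>2 \<le> 2 * x\<^sup>2 + 2 * y\<^sup>2" for y
        using sum_squares_bound[of x y] by (simp add: power2_sum)
      then have "(\<integral>\<^sup>+y. ennreal ((x + y)\<^sup>2) \<partial>L) \<le> (\<integral>\<^sup>+y. ennreal (2 * x\<^sup>2) + ennreal 2 * ennreal (y\<^sup>2) \<partial>L)"
        by (intro nn_integral_mono) (simp add: ennreal_mult'[symmetric] ennreal_plus[symmetric] ennreal_leI del: ennreal_plus ennreal_numeral)
      also have "\<dots> = ennreal (2 * x\<^sup>2) + ennreal 2 * ennreal W"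
        by (simp add: nn_integral_add nn_integral_cmult L.emeasure_space_1 W)
      finally show ?thesis
        using VW by (simp add: ennreal_mult' del: ennreal_numeral)
    qed
    then have "(\<integral>\<^sup>+x. (\<integral>\<^sup>+y. ennreal ((x + y)\<^sup>2) \<partial>L) \<partial>M) \<le> (\<integral>\<^sup>+x. ennreal 2 * ennreal (x\<^sup>2) + ennreal (2 * W) \<partial>M)"
      by (intro nn_integral_mono) (simp add: ennreal_mult')
    also have "\<dots> = ennreal 2 * ennreal V + ennreal (2 * W)"
      by (simp add: nn_integral_add nn_integral_cmult M.emeasure_space_1 V)
    also have "\<dots> = ennreal (2 * V + 2 * W)"
      using VW by (simp add: ennreal_mult'[symmetric] ennreal_plus[symmetric] del: ennreal_plus ennreal_numeral)
    finally have "(\<integral>\<^sup>+x. ennreal (x\<^sup>2) \<partial>M') \<le> ennreal (1 - l) * ennreal V + ennreal l * ennreal (2 * V + 2 * W)"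
      by (simp add: nn V mult_left_mono)
    also have "\<dots> = ennreal (V + l * (V + 2 * W))"
    proof -
      have "ennreal (1 - l) * ennreal V + ennreal l * ennreal (2 * V + 2 * W) = ennreal ((1 - l) * V) + ennreal (l * (2 * V + 2 * W))"
        using l by (simp add: ennreal_mult')
      also have "\<dots> = ennreal ((1 - l) * V + l * (2 * V + 2 * W))"
        using l VW by (intro ennreal_plus[symmetric]) auto
      finally show ?thesis
        by (simp add: algebra_simps)
    qed
    also have "\<dots> \<le> ennreal (V + \<delta>)"
      using l by (intro ennreal_leI) simp
    finally show ?thesis .
  qed
  ultimately have sb': "shift_bounded M' C" and bound: "(\<integral>\<^sup>+x. ennreal (x\<^sup>2) \<partial>M') \<le> ennreal (V + \<delta>)"
    by auto
  have [simp]: "sets M' = sets borel"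
    by (simp add: M'_def)
  have [measurable_cong]: "sets M' = sets borel"
    by simp
  have int: "integrable M' (\<lambda>x. x\<^sup>2)"
    using bound by (intro integrableI_bounded) (auto simp: le_less_trans)
  have "ennreal (\<integral>x. x\<^sup>2 \<partial>M') \<le> ennreal (V + \<delta>)"
    using bound by (subst nn_integral_eq_integral[OF int, symmetric]) simp_all
  then have "(\<integral>x. x\<^sup>2 \<partial>M') \<le> V + \<delta>"
    using VW \<open>\<delta> > 0\<close> by (subst (asm) ennreal_le_iff) auto
  moreover have "prob_space M'"
    unfolding M'_def by (rule D.prob_space_distr) simp
  ultimately show ?thesis
    using that[of M' C] C int sb' by (simp add: V_def)
qed

section \<open>The optimal variance and laws that nearly attain it\<close>

abbreviation dp_noise_laws :: "real \<Rightarrow> real measure set" where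
  "dp_noise_laws \<epsilon> \<equiv> {M. prob_space M \<and> sets M = sets borel \<and> integrable M (\<lambda>x. x\<^sup>2) \<and> shift_bounded M (exp \<epsilon>)}"

lemma sigma_star_sq_eq:
  "sigma_star_sq \<epsilon> = (INF M \<in> dp_noise_laws \<epsilon>. (\<integral>x. x\<^sup>2 \<partial>M) - (\<integral>x. x \<partial>M)\<^sup>2)"
proof -
  have "dp_noise_laws \<epsilon> = {M. prob_space M \<and> sets M = sets borel \<and> integrable M (\<lambda>x. x\<^sup>2) \<and>
      (\<forall>x' x''. \<bar>x' - x''\<bar> \<le> 1 \<longrightarrow>
         (\<forall>B \<in> sets borel. measure M {x. x' + x \<in> B} \<le> exp \<epsilon> * measure M {x. x'' + x \<in> B}))}"
    by (intro Collect_cong conj_cong refl shift_bounded_iff_measure) simp_all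
  then show ?thesis
    unfolding sigma_star_sq_def by (simp only: setcompr_eq_image)
qed

text \<open>A feasible law is needed because the infimum of an empty set of reals carries no
  information.\<close>

lemma laplace_in_dp_noise_laws:
  assumes "\<epsilon> > 0"
  shows "laplace \<epsilon> \<in> dp_noise_laws \<epsilon>"
proof -
  have "(\<integral>\<^sup>+x. f x \<partial>laplace \<epsilon>) \<le> ennreal (exp \<epsilon>) * (\<integral>\<^sup>+x. f (h + x) \<partial>laplace \<epsilon>)"
    if "\<bar>h\<bar> \<le> 1" and f: "f \<in> borel_measurable borel" for h f
  proof -
    have "\<epsilon> * \<bar>h\<bar> \<le> \<epsilon>"
      using assms that by simp
    then have "ennreal (exp (\<epsilon> * \<bar>h\<bar>)) * (\<integral>\<^sup>+x. f (h + x) \<partial>laplace \<epsilon>) \<le> ennreal (exp \<epsilon>) * (\<integral>\<^sup>+x. f (h + x) \<partial>laplace \<epsilon>)"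
      by (intro mult_right_mono ennreal_leI) auto
    then show ?thesis
      using laplace_shift[OF less_imp_le[OF assms] f, of h] by (rule order_trans[rotated])
  qed
  then show ?thesis
    using assms by (simp add: prob_space_laplace laplace_square_integrable shift_bounded_def)
qed

lemma variance_nonneg:
  assumes "prob_space M" "sets M = sets borel" "integrable M (\<lambda>x::real. x\<^sup>2)"
  shows "(\<integral>x. x\<^sup>2 \<partial>M) - (\<integral>x. x \<partial>M)\<^sup>2 \<ge> 0"
proof -
  interpret prob_space M by fact
  show ?thesis
    using variance_eq[OF integrable_of_square_integrable[OF assms] assms(3)] variance_positive[of "\<lambda>x. x"]
    by simp
qed

lemma sigma_star_sq_nonneg: "\<epsilon> > 0 \<Longrightarrow> sigma_star_sq \<epsilon> \<ge> 0"
  unfolding sigma_star_sq_eq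
proof (rule cINF_greatest)
  show "dp_noise_laws \<epsilon> \<noteq> {}" if "\<epsilon> > 0"
    using laplace_in_dp_noise_laws[OF that] by (metis empty_iff)
next
  fix M assume "M \<in> dp_noise_laws \<epsilon>"
  then show "0 \<le> (\<integral>x. x\<^sup>2 \<partial>M) - (\<integral>x. x \<partial>M)\<^sup>2"
    unfolding mem_Collect_eq by (elim conjE) (rule variance_nonneg)
qed

text \<open>Half of \<open>\<delta>\<close> pays for approaching the infimum and half for the
  mixture. Centering comes first because the mixture lemma controls the second moment, which then
  equals the variance. Centering again restores mean zero and can only lower the second
  moment.\<close>

lemma near_optimal_noise:
  assumes "\<epsilon> > 0" "\<delta> > 0"
  obtains M C where "prob_space M" "sets M = sets borel" "integrable M (\<lambda>x. x\<^sup>2)"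
    "(\<integral>x. x \<partial>M) = 0" "(\<integral>x. x\<^sup>2 \<partial>M) \<le> sigma_star_sq \<epsilon> + \<delta>" "shift_bounded M C" "0 < C" "C < exp \<epsilon>"
proof -
  let ?var = "\<lambda>M :: real measure. (\<integral>x. x\<^sup>2 \<partial>M) - (\<integral>x. x \<partial>M)\<^sup>2"
  have "\<exists>v\<in>?var ` dp_noise_laws \<epsilon>. v < sigma_star_sq \<epsilon> + \<delta> / 2"
  proof (rule cInf_lessD)
    show "?var ` dp_noise_laws \<epsilon> \<noteq> {}"
      using laplace_in_dp_noise_laws[OF assms(1)] by (simp only: image_is_empty) blast
    show "Inf (?var ` dp_noise_laws \<epsilon>) < sigma_star_sq \<epsilon> + \<delta> / 2"
      using assms(2) by (simp add: sigma_star_sq_eq)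
  qed
  then obtain M0 where M0: "prob_space M0" "sets M0 = sets borel" "integrable M0 (\<lambda>x. x\<^sup>2)"
      "shift_bounded M0 (exp \<epsilon>)" "(\<integral>x. x\<^sup>2 \<partial>M0) - (\<integral>x. x \<partial>M0)\<^sup>2 < sigma_star_sq \<epsilon> + \<delta> / 2"
    by blast
  obtain M1 where M1: "prob_space M1" "sets M1 = sets borel" "integrable M1 (\<lambda>x. x\<^sup>2)"
      "shift_bounded M1 (exp \<epsilon>)" "(\<integral>x. x\<^sup>2 \<partial>M1) = (\<integral>x. x\<^sup>2 \<partial>M0) - (\<integral>x. x \<partial>M0)\<^sup>2"
    using centered_noise[OF M0(1-4)] by metis
  obtain M2 C where M2: "prob_space M2" "sets M2 = sets borel" "integrable M2 (\<lambda>x. x\<^sup>2)"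
    "(\<integral>x. x\<^sup>2 \<partial>M2) \<le> (\<integral>x. x\<^sup>2 \<partial>M1) + \<delta> / 2" "shift_bounded M2 C" "0 < C" "C < exp \<epsilon>"
    using mixture_noise[OF M1(1-4) assms(1), of "\<delta> / 2"] assms(2) by (metis half_gt_zero)
  obtain M where M: "prob_space M" "sets M = sets borel" "integrable M (\<lambda>x. x\<^sup>2)" "(\<integral>x. x \<partial>M) = 0"
    "shift_bounded M C" "(\<integral>x. x\<^sup>2 \<partial>M) = (\<integral>x. x\<^sup>2 \<partial>M2) - (\<integral>x. x \<partial>M2)\<^sup>2"
    using centered_noise[OF M2(1-3) M2(5)] by metis
  have "(\<integral>x. x\<^sup>2 \<partial>M) \<le> sigma_star_sq \<epsilon> + \<delta>"
    using M(6) M2(4) M1(5) M0(5) zero_le_power2[of "\<integral>x. x \<partial>M2"] by linarith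
  then show ?thesis
    using that[of M C] M M2 by blast
qed

section \<open>Interpolation and robust decoding\<close>

definition lagrange_basis :: "'a::field set \<Rightarrow> 'a \<Rightarrow> 'a poly" where
  "lagrange_basis H x = smult (1 / (\<Prod>y\<in>H - {x}. x - y)) (\<Prod>y\<in>H - {x}. [:- y, 1:])"

lemma degree_lagrange_basis:
  assumes "finite H" "x \<in> H"
  shows "degree (lagrange_basis H x) < card H"
proof -
  have "degree (\<Prod>y\<in>H - {x}. [:- y, 1:]) \<le> card (H - {x})"
    using degree_prod_sum_le[of "H - {x}" "\<lambda>y. [:- y, 1:]"] assms by simp
  also have "\<dots> < card H"
    using assms by (rule card_Diff1_less)
  finally show ?thesis
    unfolding lagrange_basis_def using degree_smult_le le_less_trans by blast
qed

lemma poly_lagrange_basis: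
  assumes "finite H" "x \<in> H" "z \<in> H"
  shows "poly (lagrange_basis H x) z = (if z = x then 1 else 0)"
  using assms by (auto simp: lagrange_basis_def poly_prod prod_zero_iff)

lemma lagrange_interpolation:
  fixes P :: "'a::field poly"
  assumes "finite H" "degree P < card H"
  shows "P = (\<Sum>x\<in>H. smult (poly P x) (lagrange_basis H x))"
proof (rule poly_eqI_degree[of H])
  fix z assume "z \<in> H"
  then have "poly (\<Sum>x\<in>H. smult (poly P x) (lagrange_basis H x)) z = (\<Sum>x\<in>H. if z = x then poly P z else 0)"
    using assms unfolding poly_sum poly_smult by (intro sum.cong refl) (auto simp: poly_lagrange_basis)
  then show "poly P z = poly (\<Sum>x\<in>H. smult (poly P x) (lagrange_basis H x)) z"
    using assms \<open>z \<in> H\<close> by (simp add: sum.delta)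
next
  have "card H > 0"
    using assms by simp
  then show "degree (\<Sum>x\<in>H. smult (poly P x) (lagrange_basis H x)) < card H"
    using assms degree_lagrange_basis
    by (intro degree_sum_less) (auto intro: le_less_trans[OF degree_smult_le])
qed (use assms in simp)

text \<open>By Lagrange interpolation each coefficient is a linear combination of the values on
  \<open>H\<close>, with weights that depend on \<open>H\<close> only. Summing the weights over all
  subsets of \<open>X\<close> makes \<open>K\<close> uniform in \<open>H\<close>, as required when
  the honest nodes are unknown.\<close>

lemma coeff_bound_from_values:
  fixes X :: "real set"
  assumes "finite X"
  obtains K where "K \<ge> 0"
    "\<And>P H j \<rho>. H \<subseteq> X \<Longrightarrow> degree P < card H \<Longrightarrow> (\<And>x. x \<in> H \<Longrightarrow> \<bar>poly P x\<bar> \<le> \<rho>) \<Longrightarrow> \<rho> \<ge> 0 \<Longrightarrow> \<bar>coeff P j\<bar> \<le> K * \<rho>"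
proof -
  define c where "c H x = (\<Sum>j\<le>degree (lagrange_basis H x). \<bar>coeff (lagrange_basis H x) j\<bar>)" for H and x :: real
  have c0: "c H x \<ge> 0" for H x
    by (auto simp: c_def intro: sum_nonneg)
  have c: "\<bar>coeff (lagrange_basis H x) j\<bar> \<le> c H x" for H x j
  proof (cases "j \<le> degree (lagrange_basis H x)")
    case True
    then show ?thesis
      unfolding c_def by (intro member_le_sum[where f="\<lambda>j. \<bar>coeff (lagrange_basis H x) j\<bar>"]) auto
  next
    case False
    then show ?thesis
      using c0 by (simp add: coeff_eq_0)
  qed
  define K where "K = (\<Sum>H\<in>Pow X. \<Sum>x\<in>H. c H x)"
  show ?thesis
  proof
    show "K \<ge> 0"
      unfolding K_def using c0 by (intro sum_nonneg)
    fix P H j \<rho>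
    assume H: "H \<subseteq> X" "degree P < card H" and le: "\<And>x. x \<in> H \<Longrightarrow> \<bar>poly P x\<bar> \<le> \<rho>" and "\<rho> \<ge> 0"
    have "finite H"
      using H assms finite_subset by blast
    have "\<bar>coeff P j\<bar> = \<bar>\<Sum>x\<in>H. poly P x * coeff (lagrange_basis H x) j\<bar>"
      by (subst lagrange_interpolation[OF \<open>finite H\<close> H(2)]) (simp add: coeff_sum)
    also have "\<dots> \<le> (\<Sum>x\<in>H. \<bar>poly P x * coeff (lagrange_basis H x) j\<bar>)"
      by (rule sum_abs)
    also have "\<dots> \<le> (\<Sum>x\<in>H. \<rho> * c H x)"
      unfolding abs_mult using le c \<open>\<rho> \<ge> 0\<close> by (intro sum_mono mult_mono) auto
    also have "\<dots> = (\<Sum>x\<in>H. c H x) * \<rho>"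
      by (simp add: sum_distrib_left mult.commute)
    also have "\<dots> \<le> K * \<rho>"
      unfolding K_def using H assms c0 \<open>\<rho> \<ge> 0\<close>
      by (intro mult_right_mono member_le_sum[where f="\<lambda>H. \<Sum>x\<in>H. c H x"]) (auto intro!: sum_nonneg)
    finally show "\<bar>coeff P j\<bar> \<le> K * \<rho>" .
  qed
qed

section \<open>Decoding by a best polynomial fit\<close>

definition explains :: "nat \<Rightarrow> nat \<Rightarrow> nat \<Rightarrow> real \<Rightarrow> obs \<Rightarrow> real poly \<Rightarrow> bool" where
  "explains N T Ad \<tau> Y Q \<longleftrightarrow> degree Q \<le> T \<and>
     (\<exists>G \<subseteq> {i. i < N \<and> Y i \<noteq> None}. card {i. i < N \<and> Y i \<noteq> None} \<le> card G + Ad \<and>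
        (\<forall>i\<in>G. \<bar>the (Y i) - poly Q (real i)\<bar> \<le> \<tau>))"

text \<open>The tolerance runs over integer multiples of \<open>\<tau>\<close>, so a least one
  exists by well-ordering; the rounding accounts for the \<open>+ 1\<close> in the error bound. The
  decoder does not need the actual noise size \<open>\<rho>\<close>. Measurability of the choice is
  not claimed, since the error is defined by an upper integral.\<close>

definition decode_poly :: "nat \<Rightarrow> nat \<Rightarrow> nat \<Rightarrow> real \<Rightarrow> obs \<Rightarrow> real poly" where
  "decode_poly N T Ad \<tau> Y =
     (SOME Q. explains N T Ad (\<tau> * real (LEAST m. \<exists>Q. explains N T Ad (\<tau> * real m) Y Q)) Y Q)"

text \<open>The true polynomial is one of the candidates, so the selected fit is at most one unit of
  tolerance worse. Both are close to the honest values on at least \<open>T + 1\<close> common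
  nodes, which determine a polynomial of degree at most \<open>T\<close> stably.\<close>

lemma decode_poly_accurate:
  assumes "N \<ge> T + E + 2 * Ad + 1"
  obtains K where "K \<ge> 0"
    "\<And>Er Av Y c P \<rho> \<tau> j. Er \<subseteq> {..<N} \<Longrightarrow> card Er \<le> E \<Longrightarrow> card Av \<le> Ad \<Longrightarrow> finite Av \<Longrightarrow>
       Y \<in> admissible_outputs N Er Av c \<Longrightarrow> degree P \<le> T \<Longrightarrow> \<tau> \<ge> 0 \<Longrightarrow> \<rho> \<ge> 0 \<Longrightarrow>
       (\<And>i. i < N \<Longrightarrow> \<bar>c i - poly P (real i)\<bar> \<le> \<tau> * \<rho>) \<Longrightarrow>
       \<bar>coeff (decode_poly N T Ad \<tau> Y) j - coeff P j\<bar> \<le> K * (\<tau> * (2 * \<rho> + 1))"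
proof -
  obtain K where K: "K \<ge> 0"
    "\<And>P H j \<rho>. H \<subseteq> real ` {..<N} \<Longrightarrow> degree P < card H \<Longrightarrow> (\<And>x. x \<in> H \<Longrightarrow> \<bar>poly P x\<bar> \<le> \<rho>) \<Longrightarrow> \<rho> \<ge> 0 \<Longrightarrow> \<bar>coeff P j\<bar> \<le> K * \<rho>"
    using coeff_bound_from_values[of "real ` {..<N}"] by blast
  show ?thesis
  proof
    show "K \<ge> 0" by (fact K(1))
    fix Er Av :: "nat set" and Y c P \<rho> \<tau> j
    assume Er: "Er \<subseteq> {..<N}" "card Er \<le> E" and Av: "card Av \<le> Ad" "finite Av"
      and Y: "Y \<in> admissible_outputs N Er Av c" and P: "degree P \<le> T" and nn: "\<tau> \<ge> 0" "\<rho> \<ge> 0"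
      and res: "\<And>i. i < N \<Longrightarrow> \<bar>c i - poly P (real i)\<bar> \<le> \<tau> * \<rho>"
    define S where "S = {i. i < N \<and> Y i \<noteq> None}"
    have erased: "Y i = None" if "i \<in> Er" for i
      using Y that by (simp add: admissible_outputs_def)
    have corrupted: "Y i \<noteq> None" if "i < N" "i \<in> Av" "i \<notin> Er" for i
      using Y that unfolding admissible_outputs_def mem_Collect_eq by blast
    have intact: "Y i = Some (c i)" if "i < N" "i \<notin> Er" "i \<notin> Av" for i
      using Y that by (simp add: admissible_outputs_def)
    have S_eq: "S = {..<N} - Er"
    proof (rule set_eqI)
      fix i
      show "i \<in> S \<longleftrightarrow> i \<in> {..<N} - Er"
        using erased[of i] corrupted[of i] intact[of i] by (cases "i \<in> Er"; cases "i \<in> Av") (auto simp: S_def)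
    qed
    have "finite Er"
      using Er finite_subset by blast
    have cS: "card S + E \<ge> N"
      using S_eq Er \<open>finite Er\<close> by (simp add: card_Diff_subset)
    have "finite S"
      by (simp add: S_def)
    have honest: "the (Y i) = c i" if "i \<in> S - Av" for i
      using intact[of i] that S_eq by simp
    define m where "m = (LEAST m. \<exists>Q. explains N T Ad (\<tau> * real m) Y Q)"
    \<comment> \<open>The honest surviving nodes witness that \<open>P\<close> itself is a fit, at
      the tolerance \<open>\<tau> * \<rho>\<close> rounded up.\<close>
    have "explains N T Ad (\<tau> * real (nat \<lceil>\<rho>\<rceil>)) Y P"
      unfolding explains_def S_def[symmetric]
    proof (intro conjI exI[of _ "S - Av"] ballI P)
      show "card S \<le> card (S - Av) + Ad"
        using diff_card_le_card_Diff[OF Av(2), of S] Av by linarith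
      fix i assume i: "i \<in> S - Av"
      then have "\<bar>the (Y i) - poly P (real i)\<bar> \<le> \<tau> * \<rho>"
        using honest res S_eq by auto
      also have "\<dots> \<le> \<tau> * real (nat \<lceil>\<rho>\<rceil>)"
        using nn by (intro mult_left_mono) linarith+
      finally show "\<bar>the (Y i) - poly P (real i)\<bar> \<le> \<tau> * real (nat \<lceil>\<rho>\<rceil>)" .
    qed simp
    then have P_explains: "\<exists>Q. explains N T Ad (\<tau> * real (nat \<lceil>\<rho>\<rceil>)) Y Q" ..
    then have ex: "\<exists>Q. explains N T Ad (\<tau> * real m) Y Q"
      unfolding m_def by (rule LeastI)
    have "m \<le> nat \<lceil>\<rho>\<rceil>"
      unfolding m_def using P_explains by (rule Least_le)
    then have m: "real m \<le> \<rho> + 1"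
      using nn by linarith
    define Q where "Q = decode_poly N T Ad \<tau> Y"
    have "explains N T Ad (\<tau> * real m) Y Q"
      unfolding Q_def decode_poly_def m_def[symmetric] using ex by (rule someI_ex)
    then obtain G where Q: "degree Q \<le> T" and G: "G \<subseteq> S" "card S \<le> card G + Ad"
      and Gres: "\<And>i. i \<in> G \<Longrightarrow> \<bar>the (Y i) - poly Q (real i)\<bar> \<le> \<tau> * real m"
      unfolding explains_def S_def[symmetric] by blast
    \<comment> \<open>At least \<open>N - E\<close> entries survive, the fit ignores at most
      \<open>Ad\<close> of them, and at most \<open>Ad\<close> of the others are corrupted. This is
      where \<open>N \<ge> T + E + 2 * Ad + 1\<close> enters.\<close>
    have "card (G - Av) > T"
      using diff_card_le_card_Diff[OF Av(2), of G] Av G cS assms by linarith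
    then have card: "degree (Q - P) < card (real ` (G - Av))"
      using Q P by (subst card_image) (auto intro: le_less_trans[OF degree_diff_le])
    have "\<bar>poly (Q - P) x\<bar> \<le> \<tau> * (2 * \<rho> + 1)" if x: "x \<in> real ` (G - Av)" for x
    proof -
      obtain i where i: "i \<in> G - Av" "x = real i"
        using x by auto
      have "i < N" "\<bar>c i - poly Q (real i)\<bar> \<le> \<tau> * real m"
        using Gres[of i] honest[of i] i G S_eq by auto
      moreover have "\<tau> * real m \<le> \<tau> * (\<rho> + 1)"
        using m nn by (intro mult_left_mono) auto
      ultimately show ?thesis
        using res[of i] i by (simp add: algebra_simps)
    qed
    then have "\<bar>coeff (Q - P) j\<bar> \<le> K * (\<tau> * (2 * \<rho> + 1))"
      using card G S_eq nn by (intro K(2)[where H="real ` (G - Av)"]) auto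
    then show "\<bar>coeff (decode_poly N T Ad \<tau> Y) j - coeff P j\<bar> \<le> K * (\<tau> * (2 * \<rho> + 1))"
      by (simp add: Q_def)
  qed
qed

section \<open>The noise polynomial and the decoder\<close>

text \<open>For \<open>T = 0\<close> no privacy is required and the noise vector has no coordinates,
  so the shares carry no noise.\<close>

definition lead_noise :: "nat \<Rightarrow> (nat \<Rightarrow> real) \<Rightarrow> real" where
  "lead_noise T z = (if T = 0 then 0 else z 0)"

text \<open>The exponent 3 lies strictly between the scale \<open>s\<^sup>2\<close> of the auxiliary
  terms and the decoding error of order \<open>s ^ 4\<close>. Division by either scale, in the
  privacy and in the accuracy argument, therefore leaves a factor \<open>s\<close>.\<close>

definition top_scale :: "nat \<Rightarrow> real \<Rightarrow> real" where
  "top_scale T s = (- 1) ^ (T + 1) * s ^ 3"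

definition aux_poly :: "nat \<Rightarrow> (nat \<Rightarrow> real) \<Rightarrow> real poly" where
  "aux_poly T z = (\<Sum>j=1..<T. monom (z j) j)"

text \<open>The top coefficient reuses the leading noise, so there are only \<open>T\<close> random
  coefficients, and those of degree below \<open>T\<close> already determine them.\<close>

definition noise_poly :: "nat \<Rightarrow> real \<Rightarrow> (nat \<Rightarrow> real) \<Rightarrow> real poly" where
  "noise_poly T s z = [:lead_noise T z:] + monom (top_scale T s * lead_noise T z) T + smult (s\<^sup>2) (aux_poly T z)"

lemma abs_top_scale: "s \<ge> 0 \<Longrightarrow> \<bar>top_scale T s\<bar> = s ^ 3"
  by (simp add: top_scale_def abs_mult power_abs)

lemma coeff_aux_poly: "coeff (aux_poly T z) j = (if 1 \<le> j \<and> j < T then z j else 0)"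
  by (auto simp: aux_poly_def coeff_sum coeff_monom sum.delta' intro!: sum.neutral)

lemma degree_aux_poly: "degree (aux_poly T z) \<le> T"
  by (rule degree_le) (simp add: coeff_aux_poly)

lemma degree_noise_poly: "degree (noise_poly T s z) \<le> T"
  unfolding noise_poly_def
  by (intro degree_add_le degree_monom_le order_trans[OF degree_smult_le] degree_aux_poly) simp

lemma coeff_noise_poly:
  assumes "j < T"
  shows "coeff (noise_poly T s z) j = (if j = 0 then z j else s\<^sup>2 * z j)"
  using assms by (auto simp: noise_poly_def coeff_aux_poly lead_noise_def coeff_monom coeff_pCons split: nat.split)

text \<open>Linearity in the noise vector lets a change of the secret be rewritten as a translation
  of the noise.\<close>

lemma noise_poly_affine: "noise_poly T s (\<lambda>j. x * w j + z j) = smult x (noise_poly T s w) + noise_poly T s z"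
  by (rule poly_eqI) (auto simp: noise_poly_def coeff_aux_poly lead_noise_def coeff_monom coeff_pCons algebra_simps split: nat.split)

lemma noise_poly_cong: "(\<And>j. j < T \<Longrightarrow> z j = w j) \<Longrightarrow> noise_poly T s z = noise_poly T s w"
  by (auto simp: noise_poly_def lead_noise_def aux_poly_def)

text \<open>A shift of the secret by one equals, as seen by the nodes in \<open>TT\<close>, a shift of the noise
  coordinates by \<open>w\<close>: all \<open>w j\<close> with \<open>j > 0\<close> are negligible, and the alternating sign in
  \<open>top_scale\<close> keeps \<open>w 0\<close> in \<open>[0, 1]\<close>.\<close>
lemma unit_shift:
  obtains K where "\<And>TT s. TT \<subseteq> {..<N} \<Longrightarrow> card TT = T \<Longrightarrow> 0 < s \<Longrightarrow> s \<le> 1 \<Longrightarrow>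
     \<exists>w. \<bar>w 0\<bar> \<le> 1 \<and> (\<Sum>j=1..<T. \<bar>w j\<bar>) \<le> K * s \<and> (\<forall>i\<in>TT. poly (noise_poly T s w) (real i) = 1)"
proof
  \<comment> \<open>The monic polynomial vanishing on the colluding nodes: adding a multiple of it
    to the constant 1 keeps the value 1 there.\<close>
  define M where "M = (\<lambda>TT. \<Prod>i\<in>TT. [:- real i, 1:])"
  define K where "K = (\<Sum>TT\<in>Pow {..<N}. \<Sum>j=1..<T. \<bar>coeff (M TT) j\<bar>)"
  fix TT s
  assume TT: "TT \<subseteq> {..<N}" "card TT = T" and s: "0 < s" "s \<le> (1::real)"
  have "finite TT"
    using TT finite_subset by blast
  show "\<exists>w. \<bar>w 0\<bar> \<le> 1 \<and> (\<Sum>j=1..<T. \<bar>w j\<bar>) \<le> K * s \<and> (\<forall>i\<in>TT. poly (noise_poly T s w) (real i) = 1)"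
  proof (cases "T = 0")
    case True
    then have "TT = {}"
      using TT \<open>finite TT\<close> by simp
    then show ?thesis
      using True by (intro exI[of _ "\<lambda>_. 0"]) (simp add: K_def)
  next
    case False
    define \<delta> where "\<delta> = top_scale T s"
    \<comment> \<open>The polynomial \<open>1 + p * \<delta> * M TT\<close> has top coefficient
      \<open>p * \<delta>\<close>, so it is a noise polynomial only if its constant coefficient is
      \<open>p\<close>. This linear equation determines \<open>p\<close>.\<close>
    define p where "p = 1 / (1 - \<delta> * coeff (M TT) 0)"
    \<comment> \<open>The constant coefficient of \<open>M TT\<close> has sign
      \<open>(- 1) ^ T\<close> or is zero, opposite to the sign of \<open>\<delta>\<close>. The
      denominator of \<open>p\<close> is therefore at least 1.\<close>
    have "\<delta> * coeff (M TT) 0 = (- 1) ^ T * s ^ 3 * - ((- 1) ^ T * (\<Prod>i\<in>TT. real i))"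
      using TT by (simp add: \<delta>_def top_scale_def M_def poly_0_coeff_0[symmetric] poly_prod prod_uminus)
    also have "\<dots> = - (s ^ 3 * (\<Prod>i\<in>TT. real i))"
      by (simp add: power_add[symmetric] mult_ac power_mult_distrib[symmetric])
    finally have m0: "\<delta> * coeff (M TT) 0 \<le> 0"
      using s by (simp add: prod_nonneg)
    then have p: "0 < p" "p \<le> 1" "p * (1 - \<delta> * coeff (M TT) 0) = 1"
      by (simp_all add: p_def divide_simps)
    have degM: "degree (M TT) = T"
      unfolding M_def using TT by (subst degree_prod_eq_sum_degree) auto
    have leadM: "coeff (M TT) T = 1"
      using lead_coeff_prod[of "\<lambda>i. [:- real i, 1:]" TT] degM by (simp add: M_def)
    \<comment> \<open>The middle coefficients of \<open>p * \<delta> * M TT\<close> have order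
      \<open>s ^ 3\<close>; undoing the scale \<open>s\<^sup>2\<close> of the auxiliary noise leaves
      order \<open>s\<close>.\<close>
    define w where "w = (\<lambda>j. if j = 0 then p else p * \<delta> * coeff (M TT) j / s\<^sup>2)"
    have "noise_poly T s w = [:1:] + smult (p * \<delta>) (M TT)"
    proof (rule poly_eqI)
      fix j
      consider "j = 0" | "0 < j" "j < T" | "j = T" | "j > T"
        by linarith
      then show "coeff (noise_poly T s w) j = coeff ([:1:] + smult (p * \<delta>) (M TT)) j"
      proof cases
        case 1
        then show ?thesis
          using False p(3) by (simp add: coeff_noise_poly w_def algebra_simps)
      next
        case 2
        then show ?thesis
          using s by (cases j) (simp_all add: coeff_noise_poly w_def)
      next
        case 3
        then show ?thesis
          using False leadM by (cases T) (simp_all add: noise_poly_def coeff_aux_poly lead_noise_def w_def \<delta>_def)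
      next
        case 4
        then show ?thesis
          using degM degree_noise_poly[of T s w] by (cases j) (simp_all add: coeff_eq_0)
      qed
    qed
    then have "poly (noise_poly T s w) (real i) = 1" if "i \<in> TT" for i
      using that \<open>finite TT\<close> by (auto simp: M_def poly_prod prod_zero_iff)
    moreover have "(\<Sum>j=1..<T. \<bar>w j\<bar>) \<le> K * s"
    proof -
      have "\<bar>w j\<bar> \<le> \<bar>coeff (M TT) j\<bar> * s" if "j \<in> {1..<T}" for j
      proof -
        have "\<bar>w j\<bar> = p * (\<bar>coeff (M TT) j\<bar> * s)"
          using that s p by (simp add: w_def abs_mult \<delta>_def abs_top_scale power2_eq_square power3_eq_cube)
        also have "\<dots> \<le> 1 * (\<bar>coeff (M TT) j\<bar> * s)"
          using p s by (intro mult_right_mono) auto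
        finally show ?thesis by simp
      qed
      then have "(\<Sum>j=1..<T. \<bar>w j\<bar>) \<le> (\<Sum>j=1..<T. \<bar>coeff (M TT) j\<bar>) * s"
        unfolding sum_distrib_right by (rule sum_mono)
      also have "\<dots> \<le> K * s"
        unfolding K_def using TT s
        by (intro mult_right_mono member_le_sum[where f="\<lambda>TT. \<Sum>j=1..<T. \<bar>coeff (M TT) j\<bar>"]) (auto intro: sum_nonneg)
      finally show ?thesis .
    qed
    ultimately show ?thesis
      using p by (intro exI[of _ w]) (simp add: w_def)
  qed
qed

text \<open>The factor \<open>real N ^ T\<close> dominates every power of an evaluation point that
  occurs in a noise polynomial.\<close>

definition noise_size :: "nat \<Rightarrow> nat \<Rightarrow> (nat \<Rightarrow> real) \<Rightarrow> real" where
  "noise_size N T z = real N ^ T * (\<Sum>j<T. \<bar>z j\<bar>)"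

lemma noise_size_nonneg: "noise_size N T z \<ge> 0"
  by (simp add: noise_size_def sum_nonneg)

text \<open>Everything besides the leading noise carries a factor \<open>s\<^sup>2\<close> or
  \<open>s ^ 3\<close>. A product of two such perturbations is of order \<open>s ^ 4\<close>, the
  unit of tolerance used for decoding.\<close>

lemma perturbation_bound:
  assumes "0 \<le> s" "s \<le> 1" "i < N"
  shows "\<bar>poly (noise_poly T s z) (real i) - lead_noise T z\<bar> \<le> s\<^sup>2 * noise_size N T z"
proof (cases "T = 0")
  case True
  then show ?thesis
    by (simp add: noise_poly_def lead_noise_def aux_poly_def noise_size_def)
next
  case False
  have pow: "real i ^ j \<le> real N ^ T" if "j \<le> T" for j
  proof -
    have "real i ^ j \<le> real N ^ j"
      using assms by (intro power_mono) auto
    also have "\<dots> \<le> real N ^ T"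
      using assms that by (intro power_increasing) auto
    finally show ?thesis .
  qed
  have "\<bar>poly (noise_poly T s z) (real i) - lead_noise T z\<bar>
      = \<bar>top_scale T s * z 0 * real i ^ T + s\<^sup>2 * (\<Sum>j=1..<T. z j * real i ^ j)\<bar>"
    using False by (simp add: noise_poly_def lead_noise_def aux_poly_def poly_sum poly_monom)
  also have "\<dots> \<le> s ^ 3 * \<bar>z 0\<bar> * real i ^ T + s\<^sup>2 * (\<Sum>j=1..<T. \<bar>z j\<bar> * real i ^ j)"
    using assms
    by (intro order_trans[OF abs_triangle_ineq] add_mono)
       (auto simp: abs_mult abs_top_scale intro!: mult_left_mono order_trans[OF sum_abs] sum_mono)
  also have "\<dots> \<le> s\<^sup>2 * (\<bar>z 0\<bar> * real N ^ T) + s\<^sup>2 * (\<Sum>j=1..<T. \<bar>z j\<bar> * real N ^ T)"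
  proof (intro add_mono mult_left_mono sum_mono)
    have "s ^ 3 * \<bar>z 0\<bar> * real i ^ T \<le> s\<^sup>2 * \<bar>z 0\<bar> * real N ^ T"
      using assms pow[of T] by (intro mult_mono power_decreasing) auto
    then show "s ^ 3 * \<bar>z 0\<bar> * real i ^ T \<le> s\<^sup>2 * (\<bar>z 0\<bar> * real N ^ T)"
      by (simp add: mult.assoc)
  qed (use pow in auto)
  also have "\<dots> = s\<^sup>2 * noise_size N T z"
  proof -
    have "(\<Sum>j<T. \<bar>z j\<bar>) = \<bar>z 0\<bar> + (\<Sum>j=1..<T. \<bar>z j\<bar>)"
      using False by (simp add: lessThan_atLeast0 sum.atLeast_Suc_lessThan)
    then show ?thesis
      by (simp add: noise_size_def algebra_simps sum_distrib_left)
  qed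
  finally show ?thesis .
qed

text \<open>The decoder estimates \<open>a b\<close> by \<open>a b - e f\<close>, where \<open>e\<close> and \<open>f\<close> are the errors of the linear
  estimators \<open>k (a + R)\<close> and \<open>k (b + S)\<close>: the product \<open>e f\<close> cancels the monomials that the
  product polynomial does not reveal.\<close>
lemma decoder_exists:
  assumes "N \<ge> T + E + 2 * Ad + 1"
  obtains K where "K \<ge> 0"
    "\<And>s k. 0 < s \<Longrightarrow> s \<le> 1 \<Longrightarrow> 0 \<le> k \<Longrightarrow> k \<le> 1 \<Longrightarrow>
      \<exists>d :: obs \<Rightarrow> real. \<forall>Er Av Y a b z w c. Er \<subseteq> {..<N} \<longrightarrow> Av \<subseteq> {..<N} \<longrightarrow> card Er \<le> E \<longrightarrow> card Av \<le> Ad \<longrightarrow>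
       (\<forall>i<N. c i = (a + poly (noise_poly T s z) (real i)) * (b + poly (noise_poly T s w) (real i))) \<longrightarrow>
       Y \<in> admissible_outputs N Er Av c \<longrightarrow>
       \<bar>d Y - (a * b - (a - k * (a + lead_noise T z)) * (b - k * (b + lead_noise T w)))\<bar>
         \<le> K * s * (2 * (noise_size N T z * noise_size N T w) + 1)"
proof -
  obtain K where K: "K \<ge> 0"
    "\<And>Er Av Y c P \<rho> \<tau> j. Er \<subseteq> {..<N} \<Longrightarrow> card Er \<le> E \<Longrightarrow> card Av \<le> Ad \<Longrightarrow> finite Av \<Longrightarrow>
       Y \<in> admissible_outputs N Er Av c \<Longrightarrow> degree P \<le> T \<Longrightarrow> \<tau> \<ge> 0 \<Longrightarrow> \<rho> \<ge> 0 \<Longrightarrow>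
       (\<And>i. i < N \<Longrightarrow> \<bar>c i - poly P (real i)\<bar> \<le> \<tau> * \<rho>) \<Longrightarrow>
       \<bar>coeff (decode_poly N T Ad \<tau> Y) j - coeff P j\<bar> \<le> K * (\<tau> * (2 * \<rho> + 1))"
    using decode_poly_accurate[OF assms] by metis
  show ?thesis
  proof (rule that[of "2 * K"])
    show "2 * K \<ge> 0"
      using K by simp
    fix s k :: real
    assume s: "0 < s" "s \<le> 1" and k: "0 \<le> k" "k \<le> 1"
    define \<delta> where "\<delta> = top_scale T s"
    have \<delta>: "\<bar>\<delta>\<bar> = s ^ 3" "\<delta> \<noteq> 0"
      using s abs_top_scale[of s T] by (auto simp: \<delta>_def)
    \<comment> \<open>With \<open>x = a + R\<close> and \<open>y = b + S\<close>, the target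
      \<open>a * b - (a - k * x) * (b - k * y)\<close> equals
      \<open>(2 * k - k\<^sup>2) * x * y - k * (x * S + y * R)\<close>. The two products are read
      off from the coefficients of degree 0 and \<open>T\<close>. For \<open>T = 0\<close> the
      second one vanishes.\<close>
    define d where "d = (\<lambda>Y. let Q = decode_poly N T Ad (s ^ 4) Y in
      (2 * k - k\<^sup>2) * coeff Q 0 - (if T = 0 then 0 else k / \<delta> * coeff Q T))"
    show "\<exists>d :: obs \<Rightarrow> real. \<forall>Er Av Y a b z w c. Er \<subseteq> {..<N} \<longrightarrow> Av \<subseteq> {..<N} \<longrightarrow> card Er \<le> E \<longrightarrow> card Av \<le> Ad \<longrightarrow>
       (\<forall>i<N. c i = (a + poly (noise_poly T s z) (real i)) * (b + poly (noise_poly T s w) (real i))) \<longrightarrow>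
       Y \<in> admissible_outputs N Er Av c \<longrightarrow>
       \<bar>d Y - (a * b - (a - k * (a + lead_noise T z)) * (b - k * (b + lead_noise T w)))\<bar>
         \<le> 2 * K * s * (2 * (noise_size N T z * noise_size N T w) + 1)"
    proof (intro exI[of _ d] allI impI)
      fix Er Av Y a b z w c
      assume Er: "Er \<subseteq> {..<N}" "card Er \<le> E" and Av: "Av \<subseteq> {..<N}" "card Av \<le> Ad"
        and c: "\<forall>i<N. c i = (a + poly (noise_poly T s z) (real i)) * (b + poly (noise_poly T s w) (real i))"
        and Y: "Y \<in> admissible_outputs N Er Av c"
      have "finite Av"
        using Av finite_subset by blast
      define R S where "R = lead_noise T z" and "S = lead_noise T w"
      \<comment> \<open>The product of the two share polynomials without the product of their
        perturbations, which alone could raise the degree above \<open>T\<close>.\<close>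
      define P where "P = [:(a + R) * (b + S):] + monom (\<delta> * ((a + R) * S + (b + S) * R)) T
        + smult (s\<^sup>2) (smult (a + R) (aux_poly T w) + smult (b + S) (aux_poly T z))"
      define \<rho> where "\<rho> = noise_size N T z * noise_size N T w"
      have "\<rho> \<ge> 0"
        by (simp add: \<rho>_def noise_size_nonneg)
      have degP: "degree P \<le> T"
        unfolding P_def
        by (intro degree_add_le degree_monom_le order_trans[OF degree_smult_le] degree_aux_poly) simp
      have res: "\<bar>c i - poly P (real i)\<bar> \<le> s ^ 4 * \<rho>" if "i < N" for i
      proof -
        have "c i - poly P (real i)
            = (poly (noise_poly T s z) (real i) - R) * (poly (noise_poly T s w) (real i) - S)"
          using c that by (simp add: P_def noise_poly_def R_def[symmetric] S_def[symmetric] \<delta>_def[symmetric] poly_monom algebra_simps)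
        then have "\<bar>c i - poly P (real i)\<bar> \<le> (s\<^sup>2 * noise_size N T z) * (s\<^sup>2 * noise_size N T w)"
          using s that noise_size_nonneg[of N T z]
          by (simp only: abs_mult R_def S_def) (intro mult_mono perturbation_bound, auto)
        also have "\<dots> = s ^ 4 * \<rho>"
          by (simp add: \<rho>_def power2_eq_square power4_eq_xxxx)
        finally show ?thesis .
      qed
      define Q where "Q = decode_poly N T Ad (s ^ 4) Y"
      define B where "B = K * (s ^ 4 * (2 * \<rho> + 1))"
      have close: "\<bar>coeff Q j - coeff P j\<bar> \<le> B" for j
        unfolding Q_def B_def using Er Av \<open>finite Av\<close> Y degP s \<open>\<rho> \<ge> 0\<close> res by (intro K(2)) auto
      have "B \<ge> 0"
        using close[of 0] by linarith
      have P0: "coeff P 0 = (a + R) * (b + S)"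
        by (simp add: P_def coeff_aux_poly coeff_monom R_def S_def lead_noise_def)
      have PT: "coeff P T = \<delta> * ((a + R) * S + (b + S) * R)" if "T \<noteq> 0"
        using that by (cases T) (simp_all add: P_def coeff_aux_poly)
      have RS0: "R = 0" "S = 0" if "T = 0"
        using that by (simp_all add: R_def S_def lead_noise_def)
      have "d Y - (a * b - (a - k * (a + R)) * (b - k * (b + S)))
          = (2 * k - k\<^sup>2) * (coeff Q 0 - coeff P 0) - (if T = 0 then 0 else k / \<delta> * (coeff Q T - coeff P T))"
        using \<delta> PT RS0 by (auto simp: d_def Let_def Q_def[symmetric] P0 power2_eq_square algebra_simps)
      \<comment> \<open>The second coefficient is divided by \<open>\<delta>\<close> of size
        \<open>s ^ 3\<close>, which turns the error of order \<open>s ^ 4\<close> into one of order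
        \<open>s\<close>.\<close>
      also have "\<bar>\<dots>\<bar> \<le> 1 * B + 1 / s ^ 3 * B"
      proof (rule order_trans[OF abs_triangle_ineq4], intro add_mono)
        have "k\<^sup>2 \<le> 2 * k" "2 * k - k\<^sup>2 \<le> 1"
          using k mult_right_mono[of k 1 k] zero_le_power2[of "k - 1"] by (auto simp: power2_eq_square algebra_simps)
        then show "\<bar>(2 * k - k\<^sup>2) * (coeff Q 0 - coeff P 0)\<bar> \<le> 1 * B"
          unfolding abs_mult using close[of 0] by (intro mult_mono) auto
        have "\<bar>k / \<delta>\<bar> \<le> 1 / s ^ 3"
          using k s by (simp add: abs_divide \<delta> divide_right_mono)
        then show "\<bar>if T = 0 then 0 else k / \<delta> * (coeff Q T - coeff P T)\<bar> \<le> 1 / s ^ 3 * B"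
          using mult_mono[OF _ close[of T], of "\<bar>k / \<delta>\<bar>" "1 / s ^ 3"] s \<open>B \<ge> 0\<close>
          by (simp add: abs_mult[symmetric])
      qed
      also have "1 / s ^ 3 * B = K * s * (2 * \<rho> + 1)"
        using s by (simp add: B_def power4_eq_xxxx power3_eq_cube)
      also have "1 * B \<le> K * s * (2 * \<rho> + 1)"
      proof -
        have "s ^ 4 \<le> s ^ 1"
          using s by (intro power_decreasing) auto
        then show ?thesis
          using K(1) \<open>\<rho> \<ge> 0\<close> by (simp add: B_def mult.assoc mult_left_mono mult_right_mono)
      qed
      finally show "\<bar>d Y - (a * b - (a - k * (a + lead_noise T z)) * (b - k * (b + lead_noise T w)))\<bar>
         \<le> 2 * K * s * (2 * (noise_size N T z * noise_size N T w) + 1)"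
        by (simp add: R_def S_def \<rho>_def)
    qed
  qed
qed

section \<open>Law of the shares and privacy\<close>

text \<open>No change of variables is available for a possibly non-measurable \<open>f\<close>.
  Instead a measurable majorant is built on the target space: \<open>g\<close> transported by the
  left inverse \<open>k\<close> on the range of \<open>h\<close>, and infinity on the complement,
  which has measure zero.\<close>

lemma upper_nn_integral_distr_le:
  assumes h [measurable]: "h \<in> measurable M' M" and k [measurable]: "k \<in> measurable M M'"
    and inv: "\<And>x. x \<in> space M' \<Longrightarrow> k (h x) = x"
    and range [measurable]: "Measurable.pred M (\<lambda>y. h (k y) = y)"
    and [measurable]: "g \<in> borel_measurable M'"
    and le: "\<And>x. x \<in> space M' \<Longrightarrow> f (h x) \<le> g x"
  shows "upper_nn_integral (distr M' M h) f \<le> (\<integral>\<^sup>+x. g x \<partial>M')"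
proof -
  define G where "G = (\<lambda>y. if h (k y) = y then g (k y) else \<infinity>)"
  have [measurable]: "G \<in> borel_measurable M"
    unfolding G_def by measurable
  have "f y \<le> G y" if "y \<in> space M" for y
    using le[of "k y"] measurable_space[OF k that] by (auto simp: G_def)
  then have "upper_nn_integral (distr M' M h) f \<le> (\<integral>\<^sup>+y. G y \<partial>distr M' M h)"
    unfolding upper_nn_integral_def by (intro INF_lower) auto
  also have "\<dots> = (\<integral>\<^sup>+x. G (h x) \<partial>M')"
    by (rule nn_integral_distr) measurable
  also have "\<dots> = (\<integral>\<^sup>+x. g x \<partial>M')"
    by (intro nn_integral_cong) (simp add: G_def inv)
  finally show ?thesis .
qed

lemma measurable_curried:
  assumes "case_prod f \<in> measurable (A \<Otimes>\<^sub>M B) C" "u \<in> measurable M A" "v \<in> measurable M B"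
  shows "(\<lambda>x. f (u x) (v x)) \<in> measurable M C"
  using measurable_compose[OF measurable_Pair[OF assms(2,3)] assms(1)] by simp

text \<open>The pairs \<open>(a, z)\<close> and \<open>(b, w)\<close> are independent although the
  product measure groups the variables differently; repeated use of Fubini separates them.\<close>

lemma nn_integral_product_pairs:
  assumes "prob_space A" "prob_space B" "prob_space Z" "prob_space W"
    and f [measurable]: "case_prod f \<in> borel_measurable (A \<Otimes>\<^sub>M Z)"
    and g [measurable]: "case_prod g \<in> borel_measurable (B \<Otimes>\<^sub>M W)"
  shows "(\<integral>\<^sup>+((a, b), (z, w)). f a z * g b w \<partial>((A \<Otimes>\<^sub>M B) \<Otimes>\<^sub>M (Z \<Otimes>\<^sub>M W)))
       = (\<integral>\<^sup>+a. \<integral>\<^sup>+z. f a z \<partial>Z \<partial>A) * (\<integral>\<^sup>+b. \<integral>\<^sup>+w. g b w \<partial>W \<partial>B)"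
proof -
  interpret A: prob_space A by fact
  interpret B: prob_space B by fact
  interpret Z: prob_space Z by fact
  interpret W: prob_space W by fact
  interpret ZW: pair_prob_space Z W ..
  note [measurable] = measurable_curried[OF f] measurable_curried[OF g]
  have Zf [measurable]: "(\<lambda>a. \<integral>\<^sup>+z. f a z \<partial>Z) \<in> borel_measurable A"
    by (rule Z.borel_measurable_nn_integral) measurable
  have Wg [measurable]: "(\<lambda>b. \<integral>\<^sup>+w. g b w \<partial>W) \<in> borel_measurable B"
    by (rule W.borel_measurable_nn_integral) measurable
  have fg: "(\<lambda>p. f (fst (fst p)) (fst (snd p)) * g (snd (fst p)) (snd (snd p)))
      \<in> borel_measurable ((A \<Otimes>\<^sub>M B) \<Otimes>\<^sub>M (Z \<Otimes>\<^sub>M W))"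
    by measurable
  have "(\<integral>\<^sup>+((a, b), (z, w)). f a z * g b w \<partial>((A \<Otimes>\<^sub>M B) \<Otimes>\<^sub>M (Z \<Otimes>\<^sub>M W)))
      = (\<integral>\<^sup>+p. (\<integral>\<^sup>+q. f (fst p) (fst q) * g (snd p) (snd q) \<partial>(Z \<Otimes>\<^sub>M W)) \<partial>(A \<Otimes>\<^sub>M B))"
    using ZW.nn_integral_fst[OF fg] by (simp add: case_prod_unfold)
  also have "\<dots> = (\<integral>\<^sup>+p. (\<integral>\<^sup>+z. f (fst p) z \<partial>Z) * (\<integral>\<^sup>+w. g (snd p) w \<partial>W) \<partial>(A \<Otimes>\<^sub>M B))"
  proof (intro nn_integral_cong)
    fix p assume "p \<in> space (A \<Otimes>\<^sub>M B)"
    then have p: "fst p \<in> space A" "snd p \<in> space B"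
      by (auto simp: space_pair_measure)
    note [measurable] = p
    show "(\<integral>\<^sup>+q. f (fst p) (fst q) * g (snd p) (snd q) \<partial>(Z \<Otimes>\<^sub>M W))
        = (\<integral>\<^sup>+z. f (fst p) z \<partial>Z) * (\<integral>\<^sup>+w. g (snd p) w \<partial>W)"
      using p by (subst W.nn_integral_fst[symmetric]) (simp_all add: nn_integral_cmult nn_integral_multc)
  qed
  also have "\<dots> = (\<integral>\<^sup>+a. (\<integral>\<^sup>+b. (\<integral>\<^sup>+z. f a z \<partial>Z) * (\<integral>\<^sup>+w. g b w \<partial>W) \<partial>B) \<partial>A)"
    by (subst B.nn_integral_fst[symmetric]) simp_all
  also have "\<dots> = (\<integral>\<^sup>+a. \<integral>\<^sup>+z. f a z \<partial>Z \<partial>A) * (\<integral>\<^sup>+b. \<integral>\<^sup>+w. g b w \<partial>W \<partial>B)"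
    by (simp add: nn_integral_cmult nn_integral_multc)
  finally show ?thesis .
qed

section \<open>The share map and its measurable left inverse\<close>

definition share_noise :: "nat \<Rightarrow> nat \<Rightarrow> real \<Rightarrow> (nat \<Rightarrow> real) \<Rightarrow> nat \<Rightarrow> real" where
  "share_noise N T s z = (\<lambda>i\<in>{..<N}. poly (noise_poly T s z) (real i))"

text \<open>Interpolation through the first \<open>T + 1\<close> nodes, followed by removal of the
  scale \<open>s\<^sup>2\<close> from the auxiliary coefficients. It supplies the left inverse
  demanded by \<open>upper_nn_integral_distr_le\<close>.\<close>

definition recover_noise :: "nat \<Rightarrow> real \<Rightarrow> (nat \<Rightarrow> real) \<Rightarrow> nat \<Rightarrow> real" where
  "recover_noise T s r = (\<lambda>j\<in>{..<T}.
     (\<Sum>i\<le>T. r i * coeff (lagrange_basis (real ` {..T}) (real i)) j) / (if j = 0 then 1 else s\<^sup>2))"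

lemma recover_share_noise:
  assumes "T < N" "s \<noteq> 0" "z \<in> extensional {..<T}"
  shows "recover_noise T s (share_noise N T s z) = z"
proof
  fix j
  let ?P = "noise_poly T s z"
  have "?P = (\<Sum>x\<in>real ` {..T}. smult (poly ?P x) (lagrange_basis (real ` {..T}) x))"
    using degree_noise_poly[of T s z] by (intro lagrange_interpolation) (simp_all add: card_image)
  also have "\<dots> = (\<Sum>i\<le>T. smult (poly ?P (real i)) (lagrange_basis (real ` {..T}) (real i)))"
    by (subst sum.reindex) simp_all
  finally have "coeff ?P j = (\<Sum>i\<le>T. poly ?P (real i) * coeff (lagrange_basis (real ` {..T}) (real i)) j)"
    by (metis (no_types, lifting) coeff_sum coeff_smult sum.cong)
  also have "\<dots> = (\<Sum>i\<le>T. share_noise N T s z i * coeff (lagrange_basis (real ` {..T}) (real i)) j)"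
    using assms by (intro sum.cong) (simp_all add: share_noise_def)
  finally show "recover_noise T s (share_noise N T s z) j = z j"
    using assms by (auto simp: recover_noise_def coeff_noise_poly extensional_def field_simps)
qed

lemma measurable_noise_poly [measurable]:
  "(\<lambda>z. poly (noise_poly T s z) x) \<in> borel_measurable (PiM {..<T} (\<lambda>_. borel))"
proof (cases "T = 0")
  case True
  then show ?thesis
    by (simp add: noise_poly_def lead_noise_def aux_poly_def)
next
  case False
  then have [measurable]: "(\<lambda>z. z 0) \<in> borel_measurable (PiM {..<T} (\<lambda>_. borel :: real measure))"
    by (intro measurable_component_singleton) simp
  have [measurable]: "(\<lambda>z. \<Sum>j=1..<T. z j * x ^ j) \<in> borel_measurable (PiM {..<T} (\<lambda>_. borel))"
    by (intro borel_measurable_sum borel_measurable_times measurable_component_singleton) auto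
  have "(\<lambda>z. poly (noise_poly T s z) x)
      = (\<lambda>z. z 0 + top_scale T s * z 0 * x ^ T + s\<^sup>2 * (\<Sum>j=1..<T. z j * x ^ j))"
    using False by (simp add: noise_poly_def lead_noise_def aux_poly_def poly_sum poly_monom fun_eq_iff)
  then show ?thesis
    by simp
qed

lemma measurable_share_noise [measurable]:
  "share_noise N T s \<in> measurable (PiM {..<T} (\<lambda>_. borel)) (PiM {..<N} (\<lambda>_. borel))"
  unfolding share_noise_def by (rule measurable_restrict) (rule measurable_noise_poly)

lemma measurable_recover_noise [measurable]:
  assumes "T < N"
  shows "recover_noise T s \<in> measurable (PiM {..<N} (\<lambda>_. borel)) (PiM {..<T} (\<lambda>_. borel))"
  unfolding recover_noise_def using assms
  by (intro measurable_restrict borel_measurable_divide borel_measurable_sum borel_measurable_times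
      measurable_component_singleton) auto

text \<open>Equality of two vectors with index set \<open>{..<N}\<close> is a finite conjunction of
  equalities between measurable real functions.\<close>

lemma pred_share_recover_noise [measurable]:
  assumes "T < N"
  shows "Measurable.pred (PiM {..<N} (\<lambda>_. borel)) (\<lambda>r. share_noise N T s (recover_noise T s r) = r)"
proof -
  note [measurable] = measurable_recover_noise[OF assms]
  have "Measurable.pred (PiM {..<N} (\<lambda>_. borel :: real measure))
      (\<lambda>r. poly (noise_poly T s (recover_noise T s r)) (real i) = r i)" if "i \<in> {..<N}" for i
  proof -
    have [measurable]: "(\<lambda>r. r i) \<in> borel_measurable (PiM {..<N} (\<lambda>_. borel :: real measure))"
      using that by (rule measurable_component_singleton)
    have [measurable]: "(\<lambda>r. poly (noise_poly T s (recover_noise T s r)) (real i)) \<in> borel_measurable (PiM {..<N} (\<lambda>_. borel))"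
      by (rule measurable_compose[OF measurable_recover_noise[OF assms] measurable_noise_poly])
    show ?thesis
      unfolding pred_def by (rule borel_measurable_eq) measurable
  qed
  then have "Measurable.pred (PiM {..<N} (\<lambda>_. borel :: real measure))
      (\<lambda>r. \<forall>i\<in>{..<N}. poly (noise_poly T s (recover_noise T s r)) (real i) = r i)"
    by (intro pred_intros_finite) simp_all
  also have "?this \<longleftrightarrow> ?thesis"
    by (intro measurable_cong) (auto simp: share_noise_def space_PiM PiE_def extensional_def fun_eq_iff restrict_def)
  finally show ?thesis .
qed

section \<open>The probability space of the noise coefficients\<close>

locale noise_space =
  fixes T :: nat and \<mu> :: "real measure"
  assumes prob_\<mu>: "prob_space \<mu>" and sets_\<mu>: "sets \<mu> = sets borel"
    and square_\<mu>: "integrable \<mu> (\<lambda>x. x\<^sup>2)" and mean_\<mu>: "(\<integral>x. x \<partial>\<mu>) = 0"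
begin

text \<open>The scale \<open>s\<close> enters only through \<open>noise_poly\<close>, so these laws
  and their moments stay fixed as \<open>s\<close> tends to 0. Rate 1 is enough because the
  auxiliary coordinates are shifted by \<open>O(s)\<close> only.\<close>

definition coord :: "nat \<Rightarrow> real measure" where
  "coord j = (if j = 0 then \<mu> else laplace 1)"

definition \<Omega> :: "(nat \<Rightarrow> real) measure" where
  "\<Omega> = PiM {..<T} coord"

lemma coord: "prob_space (coord j)" "integrable (coord j) (\<lambda>x. x\<^sup>2)" "(\<integral>x. x \<partial>coord j) = 0"
  by (simp_all add: coord_def prob_\<mu> square_\<mu> mean_\<mu> prob_space_laplace laplace_square_integrable laplace_mean)

lemma sets_coord [simp, measurable_cong]: "sets (coord j) = sets borel"
  by (simp add: coord_def sets_\<mu>)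

lemma sets_\<Omega> [simp, measurable_cong]: "sets \<Omega> = sets (PiM {..<T} (\<lambda>_. borel))"
  unfolding \<Omega>_def by (rule sets_PiM_cong) simp_all

sublocale \<Omega>: prob_space \<Omega>
  unfolding \<Omega>_def by (intro prob_space_PiM coord)

lemma measurable_coord_\<Omega> [measurable]: "j < T \<Longrightarrow> (\<lambda>z. z j) \<in> borel_measurable \<Omega>"
  unfolding measurable_cong_sets[OF sets_\<Omega> refl] by (rule measurable_component_singleton) simp

lemma distr_coord:
  assumes "j < T"
  shows "distr \<Omega> borel (\<lambda>z. z j) = coord j"
proof -
  have "distr \<Omega> borel (\<lambda>z. z j) = distr \<Omega> (coord j) (\<lambda>z. z j)"
    by (rule distr_cong) simp_all
  also have "\<dots> = coord j"
    unfolding \<Omega>_def using assms coord(1) by (intro distr_PiM_component) simp_all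
  finally show ?thesis .
qed

lemma
  assumes "j < T"
  shows integrable_coord_\<Omega>: "integrable \<Omega> (\<lambda>z. z j)"
    and mean_coord_\<Omega>: "(\<integral>z. z j \<partial>\<Omega>) = 0"
    and square_coord_\<Omega>: "integrable \<Omega> (\<lambda>z. (z j)\<^sup>2)"
    and second_moment_coord_\<Omega>: "(\<integral>z. (z j)\<^sup>2 \<partial>\<Omega>) = (\<integral>x. x\<^sup>2 \<partial>coord j)"
proof -
  note [measurable] = measurable_coord_\<Omega>[OF assms]
  have "integrable (distr \<Omega> borel (\<lambda>z. z j)) (\<lambda>x. x)"
    unfolding distr_coord[OF assms] by (intro integrable_of_square_integrable coord) simp
  then show "integrable \<Omega> (\<lambda>z. z j)"
    by (subst (asm) integrable_distr_eq) simp_all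
  have "integrable (distr \<Omega> borel (\<lambda>z. z j)) (\<lambda>x. x\<^sup>2)"
    unfolding distr_coord[OF assms] by (rule coord)
  then show "integrable \<Omega> (\<lambda>z. (z j)\<^sup>2)"
    by (subst (asm) integrable_distr_eq) simp_all
  show "(\<integral>z. z j \<partial>\<Omega>) = 0"
    unfolding coord(3)[of j, symmetric] distr_coord[OF assms, symmetric]
    by (rule integral_distr[symmetric]) measurable
  show "(\<integral>z. (z j)\<^sup>2 \<partial>\<Omega>) = (\<integral>x. x\<^sup>2 \<partial>coord j)"
    unfolding distr_coord[OF assms, symmetric] by (rule integral_distr[symmetric]) measurable
qed

text \<open>The second moment is an inequality because the leading noise is zero for
  \<open>T = 0\<close>; otherwise it has law \<open>\<mu>\<close>.\<close>

lemma
  shows measurable_lead_noise [measurable]: "lead_noise T \<in> borel_measurable \<Omega>"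
    and integrable_lead_noise: "integrable \<Omega> (lead_noise T)"
    and mean_lead_noise: "(\<integral>z. lead_noise T z \<partial>\<Omega>) = 0"
    and square_lead_noise: "integrable \<Omega> (\<lambda>z. (lead_noise T z)\<^sup>2)"
    and second_moment_lead_noise: "(\<integral>z. (lead_noise T z)\<^sup>2 \<partial>\<Omega>) \<le> (\<integral>x. x\<^sup>2 \<partial>\<mu>)"
proof -
  have eq: "lead_noise T = (if T = 0 then (\<lambda>_. 0) else (\<lambda>z. z 0))"
    by (simp add: lead_noise_def fun_eq_iff)
  show "integrable \<Omega> (lead_noise T)" "(\<integral>z. lead_noise T z \<partial>\<Omega>) = 0" "integrable \<Omega> (\<lambda>z. (lead_noise T z)\<^sup>2)"
      "(\<integral>z. (lead_noise T z)\<^sup>2 \<partial>\<Omega>) \<le> (\<integral>x. x\<^sup>2 \<partial>\<mu>)"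
    using integrable_coord_\<Omega>[of 0] mean_coord_\<Omega>[of 0] square_coord_\<Omega>[of 0] second_moment_coord_\<Omega>[of 0]
    by (auto simp: eq coord_def)
  then show "lead_noise T \<in> borel_measurable \<Omega>"
    by blast
qed

text \<open>The Cauchy-Schwarz inequality bounds the square of the sum by a multiple of the sum of
  squares.\<close>

lemma integrable_noise_size: "integrable \<Omega> (\<lambda>z. (noise_size N T z)\<^sup>2)"
proof (rule Bochner_Integration.integrable_bound)
  show "integrable \<Omega> (\<lambda>z. (real N ^ T)\<^sup>2 * ((\<Sum>j<T. (z j)\<^sup>2) * real T))"
    by (intro integrable_mult_right integrable_mult_left Bochner_Integration.integrable_sum square_coord_\<Omega>) simp
  show "(\<lambda>z. (noise_size N T z)\<^sup>2) \<in> borel_measurable \<Omega>"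
    unfolding noise_size_def
    by (intro borel_measurable_power borel_measurable_times borel_measurable_sum borel_measurable_abs measurable_coord_\<Omega>) auto
  show "AE z in \<Omega>. norm ((noise_size N T z)\<^sup>2) \<le> norm ((real N ^ T)\<^sup>2 * ((\<Sum>j<T. (z j)\<^sup>2) * real T))"
  proof (intro AE_I2)
    fix z
    have "(\<Sum>j<T. \<bar>z j\<bar>)\<^sup>2 \<le> (\<Sum>j<T. (z j)\<^sup>2) * real T"
      using sum_squared_le_sum_of_squares[of "\<lambda>j. \<bar>z j\<bar>" "{..<T}"] by simp
    then show "norm ((noise_size N T z)\<^sup>2) \<le> norm ((real N ^ T)\<^sup>2 * ((\<Sum>j<T. (z j)\<^sup>2) * real T))"
      by (simp add: noise_size_def power_mult_distrib abs_mult sum_nonneg mult_left_mono)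
  qed
qed

definition share_law :: "nat \<Rightarrow> real \<Rightarrow> (nat \<Rightarrow> real) measure" where
  "share_law N s = distr \<Omega> (PiM {..<N} (\<lambda>_. borel)) (share_noise N T s)"

lemma noise_law_share_law: "noise_law N (share_law N s)"
  unfolding noise_law_def
proof (intro conjI allI impI)
  show "prob_space (share_law N s)"
    unfolding share_law_def by (rule \<Omega>.prob_space_distr) measurable
  show "sets (share_law N s) = sets (PiM {..<N} (\<lambda>_. borel))"
    by (simp add: share_law_def)
  fix i assume i: "i < N"
  have eq: "share_noise N T s z i
      = lead_noise T z + top_scale T s * lead_noise T z * real i ^ T + s\<^sup>2 * (\<Sum>j=1..<T. z j * real i ^ j)" for z
    using i by (simp add: share_noise_def noise_poly_def aux_poly_def poly_sum poly_monom)
  have aux: "integrable \<Omega> (\<lambda>z. \<Sum>j=1..<T. z j * real i ^ j)"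
    by (intro Bochner_Integration.integrable_sum integrable_mult_left integrable_coord_\<Omega>) simp
  have aux0: "(\<integral>z. (\<Sum>j=1..<T. z j * real i ^ j) \<partial>\<Omega>) = 0"
    by (subst Bochner_Integration.integral_sum)
       (auto intro!: integrable_mult_left integrable_coord_\<Omega> sum.neutral simp: mean_coord_\<Omega>)
  have "integrable \<Omega> (\<lambda>z. share_noise N T s z i)"
    unfolding eq using integrable_lead_noise aux by simp
  then show "integrable (share_law N s) (\<lambda>r. r i)"
    unfolding share_law_def using i by (subst integrable_distr_eq) auto
  have "(\<integral>r. r i \<partial>share_law N s) = (\<integral>z. share_noise N T s z i \<partial>\<Omega>)"
    unfolding share_law_def using i by (subst integral_distr) auto
  also have "\<dots> = 0"
    unfolding eq using integrable_lead_noise aux aux0 mean_lead_noise by simp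
  finally show "(\<integral>r. r i \<partial>share_law N s) = 0" .
qed

text \<open>Replacing the secret \<open>x0\<close> by \<open>x1\<close> amounts to translating the
  noise by \<open>(x1 - x0) * w\<close>. Coordinate 0 costs the factor
  \<open>C < exp \<epsilon>\<close> in the application, and the Laplace coordinates together cost at
  most \<open>exp (K * s)\<close>.\<close>

lemma node_dp_share_law:
  assumes sb: "shift_bounded \<mu> C" and "0 \<le> C" "0 \<le> \<epsilon>" and small: "C * exp (K * s) \<le> exp \<epsilon>"
    and shift: "\<And>TT. TT \<subseteq> {..<N} \<Longrightarrow> card TT = T \<Longrightarrow>
      \<exists>w. \<bar>w 0\<bar> \<le> 1 \<and> (\<Sum>j=1..<T. \<bar>w j\<bar>) \<le> K * s \<and> (\<forall>i\<in>TT. poly (noise_poly T s w) (real i) = 1)"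
  shows "node_dp N T \<epsilon> (share_law N s)"
  unfolding node_dp_def
proof (intro allI impI ballI)
  fix x0 x1 :: real and TT and B
  assume x: "\<bar>x0 - x1\<bar> \<le> 1" and TT: "TT \<subseteq> {..<N} \<and> card TT = T"
    and B [measurable]: "B \<in> sets (PiM TT (\<lambda>_. borel :: real measure))"
  obtain w where w: "\<bar>w 0\<bar> \<le> 1" "(\<Sum>j=1..<T. \<bar>w j\<bar>) \<le> K * s" "\<And>i. i \<in> TT \<Longrightarrow> poly (noise_poly T s w) (real i) = 1"
    using shift TT by blast
  interpret P: prob_space "share_law N s"
    using noise_law_share_law by (simp add: noise_law_def)
  define f :: "(nat \<Rightarrow> real) \<Rightarrow> ennreal" where "f = (\<lambda>z. indicator B (\<lambda>i\<in>TT. poly (noise_poly T s z) (real i)))"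
  have f [measurable]: "f \<in> borel_measurable (PiM {..<T} (\<lambda>_. borel))"
    unfolding f_def by measurable
  \<comment> \<open>The noise polynomial of \<open>w\<close> equals 1 on \<open>TT\<close>, so
    adding \<open>x\<close> to these shares is the same as adding \<open>x * w\<close> to the
    noise.\<close>
  have law: "ennreal (measure (share_law N s) {r \<in> space (share_law N s). (\<lambda>i\<in>TT. x + r i) \<in> B})
      = (\<integral>\<^sup>+z. f (\<lambda>j. x * w j + z j) \<partial>\<Omega>)" for x
  proof -
    have [measurable]: "(\<lambda>r. \<lambda>i\<in>TT. x + r i) \<in> measurable (PiM {..<N} (\<lambda>_. borel)) (PiM TT (\<lambda>_. borel :: real measure))"
      using TT by (intro measurable_restrict borel_measurable_add measurable_const measurable_component_singleton) auto
    have [measurable_cong]: "sets (share_law N s) = sets (PiM {..<N} (\<lambda>_. borel))"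
      by (simp add: share_law_def)
    have "ennreal (measure (share_law N s) {r \<in> space (share_law N s). (\<lambda>i\<in>TT. x + r i) \<in> B})
        = emeasure (share_law N s) {r \<in> space (share_law N s). (\<lambda>i\<in>TT. x + r i) \<in> B}"
      by (simp add: P.emeasure_eq_measure)
    also have "\<dots> = (\<integral>\<^sup>+r. indicator {r \<in> space (share_law N s). (\<lambda>i\<in>TT. x + r i) \<in> B} r \<partial>share_law N s)"
      by (rule nn_integral_indicator[symmetric]) measurable
    also have "\<dots> = (\<integral>\<^sup>+r. indicator B (\<lambda>i\<in>TT. x + r i) \<partial>share_law N s)"
      by (intro nn_integral_cong) (simp split: split_indicator)
    also have "\<dots> = (\<integral>\<^sup>+z. indicator B (\<lambda>i\<in>TT. x + share_noise N T s z i) \<partial>\<Omega>)"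
      unfolding share_law_def by (rule nn_integral_distr) measurable
    also have "\<dots> = (\<integral>\<^sup>+z. f (\<lambda>j. x * w j + z j) \<partial>\<Omega>)"
    proof (intro nn_integral_cong)
      fix z
      have "(\<lambda>i\<in>TT. x + share_noise N T s z i) = (\<lambda>i\<in>TT. poly (noise_poly T s (\<lambda>j. x * w j + z j)) (real i))"
        using TT w(3) by (intro restrict_ext) (auto simp: noise_poly_affine share_noise_def)
      then show "indicator B (\<lambda>i\<in>TT. x + share_noise N T s z i) = f (\<lambda>j. x * w j + z j)"
        by (simp add: f_def)
    qed
    finally show ?thesis .
  qed
  \<comment> \<open>\<open>F\<close> already contains the secret \<open>x0\<close>, so translating
    its argument by \<open>h\<close> produces \<open>x1\<close>. The restriction matches the form of
    the translation in \<open>PiM_shift\<close>.\<close>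
  define F where "F = (\<lambda>z. f (\<lambda>j\<in>{..<T}. x0 * w j + z j))"
  have f_cong: "f z = f z'" if "\<And>j. j < T \<Longrightarrow> z j = z' j" for z z'
    using noise_poly_cong[of T z z' s] that by (simp add: f_def)
  define h where "h = (\<lambda>j. (x1 - x0) * w j)"
  define D where "D = (\<lambda>j. if j = 0 then C else exp (1 * \<bar>h j\<bar>))"
  have "(\<integral>\<^sup>+z. F z \<partial>PiM {..<T} coord) \<le> ennreal (\<Prod>j<T. D j) * (\<integral>\<^sup>+z. F (\<lambda>j\<in>{..<T}. h j + z j) \<partial>PiM {..<T} coord)"
  proof (rule PiM_shift)
    fix j and g :: "real \<Rightarrow> ennreal"
    assume g: "g \<in> borel_measurable borel"
    have "\<bar>h 0\<bar> \<le> 1"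
      using x w(1) mult_mono[of "\<bar>x1 - x0\<bar>" 1 "\<bar>w 0\<bar>" 1] by (simp add: h_def abs_mult)
    then show "(\<integral>\<^sup>+x. g x \<partial>coord j) \<le> ennreal (D j) * (\<integral>\<^sup>+x. g (h j + x) \<partial>coord j)"
      using shift_boundedD[OF sb _ g, of "h 0"] laplace_shift[OF _ g, of 1 "h j"] by (auto simp: coord_def D_def)
  next
    show "F \<in> borel_measurable (PiM {..<T} (\<lambda>_. borel))"
      unfolding F_def by measurable
  qed (use coord(1) \<open>0 \<le> C\<close> in \<open>simp_all add: D_def\<close>)
  moreover have "F (\<lambda>j\<in>{..<T}. h j + z j) = f (\<lambda>j. x1 * w j + z j)" for z
    unfolding F_def by (rule f_cong) (simp add: h_def algebra_simps)
  moreover have "F z = f (\<lambda>j. x0 * w j + z j)" for z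
    unfolding F_def by (rule f_cong) simp
  moreover have "(\<Prod>j<T. D j) \<le> exp \<epsilon>"
  proof (cases "T = 0")
    case False
    have "(\<Prod>j<T. D j) = C * (\<Prod>j=1..<T. exp \<bar>h j\<bar>)"
      using False by (simp add: lessThan_atLeast0 prod.atLeast_Suc_lessThan D_def)
    also have "\<dots> = C * exp (\<Sum>j=1..<T. \<bar>h j\<bar>)"
      by (simp add: exp_sum)
    also have "(\<Sum>j=1..<T. \<bar>h j\<bar>) \<le> (\<Sum>j=1..<T. \<bar>w j\<bar>)"
      using x by (intro sum_mono) (simp add: h_def abs_mult mult_left_le_one_le)
    also have "\<dots> \<le> K * s"
      by (fact w(2))
    finally show ?thesis
      using small \<open>0 \<le> C\<close> by (simp add: mult_left_mono)
  qed (use \<open>0 \<le> \<epsilon>\<close> in simp)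
  ultimately have "(\<integral>\<^sup>+z. f (\<lambda>j. x0 * w j + z j) \<partial>\<Omega>) \<le> ennreal (exp \<epsilon>) * (\<integral>\<^sup>+z. f (\<lambda>j. x1 * w j + z j) \<partial>\<Omega>)"
    unfolding \<Omega>_def by (auto elim!: order_trans intro!: mult_right_mono ennreal_leI)
  then show "measure (share_law N s) {r \<in> space (share_law N s). (\<lambda>i\<in>TT. x0 + r i) \<in> B}
      \<le> exp \<epsilon> * measure (share_law N s) {r \<in> space (share_law N s). (\<lambda>i\<in>TT. x1 + r i) \<in> B}"
    by (simp add: law[symmetric] ennreal_mult'[symmetric])
qed

end

section \<open>Mean square error\<close>

text \<open>The cross term is split with weight \<open>\<theta>\<close>, so that the factor of the
  main term \<open>x\<^sup>2\<close> can be brought as close to 1 as desired.\<close>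

lemma square_add_le:
  fixes x y \<theta> :: real
  assumes "\<theta> > 0"
  shows "(x + y)\<^sup>2 \<le> (1 + \<theta>) * x\<^sup>2 + (1 + 1 / \<theta>) * y\<^sup>2"
proof -
  have "0 \<le> (\<theta> * x - y)\<^sup>2 / \<theta>"
    using assms by simp
  also have "\<dots> = \<theta> * x\<^sup>2 - 2 * x * y + 1 / \<theta> * y\<^sup>2"
    using assms by (simp add: power2_eq_square field_simps)
  finally show ?thesis
    by (simp add: power2_sum algebra_simps)
qed

context noise_space
begin

text \<open>For fixed \<open>a\<close> the cross term vanishes because the noise has mean zero. What
  remains is the squared bias \<open>(1 - k)\<^sup>2 * a\<^sup>2\<close> plus
  \<open>k\<^sup>2\<close> times the noise variance.\<close>

lemma estimator_error:
  assumes A: "input_law \<eta> A" and k: "0 \<le> k" "k \<le> 1"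
  shows "(\<integral>\<^sup>+a. \<integral>\<^sup>+z. ennreal ((a - k * (a + lead_noise T z))\<^sup>2) \<partial>\<Omega> \<partial>A)
       \<le> ennreal ((1 - k)\<^sup>2 * \<eta> + k\<^sup>2 * (\<integral>x. x\<^sup>2 \<partial>\<mu>))"
proof -
  interpret A: prob_space A
    using A by (simp add: input_law_def)
  have [measurable_cong]: "sets A = sets borel"
    using A by (simp add: input_law_def)
  let ?v = "\<integral>x. x\<^sup>2 \<partial>\<mu>"
  have inner: "(\<integral>\<^sup>+z. ennreal ((a - k * (a + lead_noise T z))\<^sup>2) \<partial>\<Omega>) \<le> ennreal ((1 - k)\<^sup>2 * a\<^sup>2 + k\<^sup>2 * ?v)" for a
  proof -
    have eq: "(a - k * (a + lead_noise T z))\<^sup>2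
        = (1 - k)\<^sup>2 * a\<^sup>2 - 2 * k * (1 - k) * a * lead_noise T z + k\<^sup>2 * (lead_noise T z)\<^sup>2" for z
      by (simp add: power2_eq_square algebra_simps)
    have "integrable \<Omega> (\<lambda>z. (a - k * (a + lead_noise T z))\<^sup>2)"
      unfolding eq using integrable_lead_noise square_lead_noise by simp
    then have "(\<integral>\<^sup>+z. ennreal ((a - k * (a + lead_noise T z))\<^sup>2) \<partial>\<Omega>)
        = ennreal (\<integral>z. (a - k * (a + lead_noise T z))\<^sup>2 \<partial>\<Omega>)"
      by (rule nn_integral_eq_integral) simp
    also have "(\<integral>z. (a - k * (a + lead_noise T z))\<^sup>2 \<partial>\<Omega>)
        = (1 - k)\<^sup>2 * a\<^sup>2 + k\<^sup>2 * (\<integral>z. (lead_noise T z)\<^sup>2 \<partial>\<Omega>)"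
      unfolding eq using integrable_lead_noise square_lead_noise mean_lead_noise by (simp add: \<Omega>.prob_space)
    finally show ?thesis
      using second_moment_lead_noise by (auto intro!: ennreal_leI mult_left_mono)
  qed
  have "(\<integral>\<^sup>+a. \<integral>\<^sup>+z. ennreal ((a - k * (a + lead_noise T z))\<^sup>2) \<partial>\<Omega> \<partial>A)
      \<le> (\<integral>\<^sup>+a. ennreal ((1 - k)\<^sup>2 * a\<^sup>2 + k\<^sup>2 * ?v) \<partial>A)"
    by (intro nn_integral_mono inner)
  also have "\<dots> = ennreal (\<integral>a. (1 - k)\<^sup>2 * a\<^sup>2 + k\<^sup>2 * ?v \<partial>A)"
    using A by (intro nn_integral_eq_integral) (auto simp: input_law_def)
  also have "(\<integral>a. (1 - k)\<^sup>2 * a\<^sup>2 + k\<^sup>2 * ?v \<partial>A) = (1 - k)\<^sup>2 * (\<integral>a. a\<^sup>2 \<partial>A) + k\<^sup>2 * ?v"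
    using A by (simp add: input_law_def A.prob_space)
  also have "ennreal \<dots> \<le> ennreal ((1 - k)\<^sup>2 * \<eta> + k\<^sup>2 * ?v)"
    using A by (intro ennreal_leI add_right_mono mult_left_mono) (auto simp: input_law_def)
  finally show ?thesis .
qed

text \<open>The bound on \<open>d\<close> holds for every admissible \<open>Y\<close>, so the
  supremum is dominated pointwise by a measurable function of inputs and noise. Its main term
  factors into two independent estimation errors. In the application \<open>K\<close> is
  proportional to \<open>s\<close>, which makes the second summand
  \<open>O(s\<^sup>2)\<close>.\<close>

lemma mse_share_law:
  assumes "T < N" "s > 0" "K \<ge> 0" "\<theta> > 0" and k: "0 \<le> k" "k \<le> 1"
    and A: "input_law \<eta> A" and B: "input_law \<eta> B" and "\<eta> \<ge> 0"
    and d: "\<And>Er Av Y a b z w c. Er \<subseteq> {..<N} \<Longrightarrow> Av \<subseteq> {..<N} \<Longrightarrow> card Er \<le> E \<Longrightarrow> card Av \<le> Ad \<Longrightarrow>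
       (\<And>i. i < N \<Longrightarrow> c i = (a + poly (noise_poly T s z) (real i)) * (b + poly (noise_poly T s w) (real i))) \<Longrightarrow>
       Y \<in> admissible_outputs N Er Av c \<Longrightarrow>
       \<bar>d Y - (a * b - (a - k * (a + lead_noise T z)) * (b - k * (b + lead_noise T w)))\<bar>
         \<le> K * (2 * (noise_size N T z * noise_size N T w) + 1)"
  shows "mse N E Ad A B (share_law N s) (share_law N s) d \<le>
    ennreal ((1 + \<theta>) * ((1 - k)\<^sup>2 * \<eta> + k\<^sup>2 * (\<integral>x. x\<^sup>2 \<partial>\<mu>))\<^sup>2
      + (1 + 1 / \<theta>) * K\<^sup>2 * (8 * (\<integral>z. (noise_size N T z)\<^sup>2 \<partial>\<Omega>)\<^sup>2 + 2))"
proof -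
  interpret A: prob_space A
    using A by (simp add: input_law_def)
  interpret B: prob_space B
    using B by (simp add: input_law_def)
  interpret AB: pair_prob_space A B ..
  interpret \<Omega>\<Omega>: pair_prob_space \<Omega> \<Omega> ..
  have sets_A [measurable_cong]: "sets A = sets borel" and sets_B [measurable_cong]: "sets B = sets borel"
    using A B by (simp_all add: input_law_def)
  define R where "R = (PiM {..<N} (\<lambda>_. borel) :: (nat \<Rightarrow> real) measure)"
  note [measurable] = measurable_recover_noise[OF \<open>T < N\<close>] pred_share_recover_noise[OF \<open>T < N\<close>]
  have sh [measurable]: "share_noise N T s \<in> measurable \<Omega> R"
    unfolding R_def by measurable
  have re [measurable]: "recover_noise T s \<in> measurable R \<Omega>"
    unfolding R_def by measurable
  have pr [measurable]: "Measurable.pred R (\<lambda>r. share_noise N T s (recover_noise T s r) = r)"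
    unfolding R_def by measurable
  define M where "M = (A \<Otimes>\<^sub>M B) \<Otimes>\<^sub>M (\<Omega> \<Otimes>\<^sub>M \<Omega>)"
  define h where "h = (\<lambda>(p :: real \<times> real, z, w). (p, share_noise N T s z, share_noise N T s w))"
  define h' where "h' = (\<lambda>(p :: real \<times> real, r, q). (p, recover_noise T s r, recover_noise T s q))"
  \<comment> \<open>The joint law is the image of the law of inputs and noise coefficients, so the
    error can be bounded on the space where the coefficients are independent.\<close>
  have law: "(A \<Otimes>\<^sub>M B) \<Otimes>\<^sub>M (share_law N s \<Otimes>\<^sub>M share_law N s) = distr M ((A \<Otimes>\<^sub>M B) \<Otimes>\<^sub>M (R \<Otimes>\<^sub>M R)) h"
  proof -
    have P: "prob_space (distr (\<Omega> \<Otimes>\<^sub>M \<Omega>) (R \<Otimes>\<^sub>M R) (\<lambda>(z, w). (share_noise N T s z, share_noise N T s w)))"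
      by (rule \<Omega>\<Omega>.prob_space_distr) measurable
    have "share_law N s \<Otimes>\<^sub>M share_law N s
        = distr (\<Omega> \<Otimes>\<^sub>M \<Omega>) (R \<Otimes>\<^sub>M R) (\<lambda>(z, w). (share_noise N T s z, share_noise N T s w))"
      unfolding share_law_def R_def[symmetric]
      by (intro pair_measure_distr sh prob_space_imp_sigma_finite \<Omega>.prob_space_distr)
    then have "(A \<Otimes>\<^sub>M B) \<Otimes>\<^sub>M (share_law N s \<Otimes>\<^sub>M share_law N s)
        = distr (A \<Otimes>\<^sub>M B) (A \<Otimes>\<^sub>M B) (\<lambda>p. p) \<Otimes>\<^sub>M
          distr (\<Omega> \<Otimes>\<^sub>M \<Omega>) (R \<Otimes>\<^sub>M R) (\<lambda>(z, w). (share_noise N T s z, share_noise N T s w))"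
      by (simp add: distr_id)
    also have "\<dots> = distr M ((A \<Otimes>\<^sub>M B) \<Otimes>\<^sub>M (R \<Otimes>\<^sub>M R)) (\<lambda>(p, q). (p, (\<lambda>(z, w). (share_noise N T s z, share_noise N T s w)) q))"
      unfolding M_def by (intro pair_measure_distr prob_space_imp_sigma_finite[OF P]) measurable
    also have "\<dots> = distr M ((A \<Otimes>\<^sub>M B) \<Otimes>\<^sub>M (R \<Otimes>\<^sub>M R)) h"
      by (intro distr_cong) (auto simp: h_def)
    finally show ?thesis .
  qed
  define e where "e = (\<lambda>a z. (a - k * (a + lead_noise T z))\<^sup>2)"
  define u where "u = (\<lambda>z. (noise_size N T z)\<^sup>2)"
  have [measurable]: "noise_size N T \<in> borel_measurable \<Omega>"
    unfolding noise_size_def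
    by (intro borel_measurable_times borel_measurable_sum borel_measurable_abs borel_measurable_const measurable_coord_\<Omega>) simp
  define c where "c = (1 + 1 / \<theta>) * K\<^sup>2"
  have c: "c \<ge> 0"
    using \<open>\<theta> > 0\<close> by (simp add: c_def)
  define g where "g = (\<lambda>((a, b), (z, w)). ennreal (1 + \<theta>) * (ennreal (e a z) * ennreal (e b w))
      + (ennreal (8 * c) * (ennreal (u z) * ennreal (u w)) + ennreal (2 * c)))"
  have e_meas [measurable]: "(\<lambda>(a, z). ennreal (e a z)) \<in> borel_measurable (A \<Otimes>\<^sub>M \<Omega>)"
      "(\<lambda>(b, w). ennreal (e b w)) \<in> borel_measurable (B \<Otimes>\<^sub>M \<Omega>)"
    unfolding e_def by measurable
  have u_meas [measurable]: "u \<in> borel_measurable \<Omega>"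
    unfolding u_def by measurable
  note [measurable] = measurable_curried[OF e_meas(1)] measurable_curried[OF e_meas(2)]
  let ?S = "(1 - k)\<^sup>2 * \<eta> + k\<^sup>2 * (\<integral>x. x\<^sup>2 \<partial>\<mu>)"
  have S: "?S \<ge> 0"
    using \<open>\<eta> \<ge> 0\<close> by simp
  have int_g: "(\<integral>\<^sup>+x. g x \<partial>M) \<le> ennreal ((1 + \<theta>) * ?S\<^sup>2 + c * (8 * (\<integral>z. u z \<partial>\<Omega>)\<^sup>2 + 2))"
  proof -
    have U: "(\<integral>\<^sup>+z. ennreal (u z) \<partial>\<Omega>) = ennreal (\<integral>z. u z \<partial>\<Omega>)"
      unfolding u_def by (intro nn_integral_eq_integral integrable_noise_size) simp
    have U0: "(\<integral>z. u z \<partial>\<Omega>) \<ge> 0"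
      by (simp add: u_def)
    have g1: "(\<lambda>((a, b), (z, w)). ennreal (e a z) * ennreal (e b w)) \<in> borel_measurable M"
      unfolding M_def case_prod_unfold by measurable
    have g2: "(\<lambda>((a, b), (z, w)). ennreal (u z) * ennreal (u w)) \<in> borel_measurable M"
      unfolding M_def case_prod_unfold by measurable
    have "(\<integral>\<^sup>+x. g x \<partial>M) = (\<integral>\<^sup>+x. ennreal (1 + \<theta>) * (\<lambda>((a, b), (z, w)). ennreal (e a z) * ennreal (e b w)) x
      + (ennreal (8 * c) * (\<lambda>((a, b), (z, w)). ennreal (u z) * ennreal (u w)) x + ennreal (2 * c)) \<partial>M)"
      unfolding g_def by (intro nn_integral_cong) (auto simp: case_prod_unfold)
    also have "\<dots> = ennreal (1 + \<theta>) * (\<integral>\<^sup>+((a, b), (z, w)). ennreal (e a z) * ennreal (e b w) \<partial>M)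
        + (ennreal (8 * c) * (\<integral>\<^sup>+((a, b), (z, w)). ennreal (u z) * ennreal (u w) \<partial>M) + ennreal (2 * c))"
    proof -
      interpret M: prob_space M
        unfolding M_def by (intro prob_space_pair A.prob_space_axioms B.prob_space_axioms \<Omega>.prob_space_axioms)
      show ?thesis
        using g1 g2 by (simp add: nn_integral_add nn_integral_cmult M.emeasure_space_1)
    qed
    also have "(\<integral>\<^sup>+((a, b), (z, w)). ennreal (e a z) * ennreal (e b w) \<partial>M)
        = (\<integral>\<^sup>+a. \<integral>\<^sup>+z. ennreal (e a z) \<partial>\<Omega> \<partial>A) * (\<integral>\<^sup>+b. \<integral>\<^sup>+w. ennreal (e b w) \<partial>\<Omega> \<partial>B)"
      unfolding M_def
      by (intro nn_integral_product_pairs A.prob_space_axioms B.prob_space_axioms \<Omega>.prob_space_axioms e_meas)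
    also have "(\<integral>\<^sup>+((a, b), (z, w)). ennreal (u z) * ennreal (u w) \<partial>M)
        = (\<integral>\<^sup>+a. \<integral>\<^sup>+z. ennreal (u z) \<partial>\<Omega> \<partial>A) * (\<integral>\<^sup>+b. \<integral>\<^sup>+w. ennreal (u w) \<partial>\<Omega> \<partial>B)"
      unfolding M_def
      by (intro nn_integral_product_pairs A.prob_space_axioms B.prob_space_axioms \<Omega>.prob_space_axioms) measurable
    also have "\<dots> = ennreal ((\<integral>z. u z \<partial>\<Omega>)\<^sup>2)"
      using U0 by (simp add: U A.emeasure_space_1 B.emeasure_space_1 power2_eq_square ennreal_mult')
    also have "ennreal (1 + \<theta>) * ((\<integral>\<^sup>+a. \<integral>\<^sup>+z. ennreal (e a z) \<partial>\<Omega> \<partial>A) * (\<integral>\<^sup>+b. \<integral>\<^sup>+w. ennreal (e b w) \<partial>\<Omega> \<partial>B))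
          + (ennreal (8 * c) * ennreal ((\<integral>z. u z \<partial>\<Omega>)\<^sup>2) + ennreal (2 * c))
        \<le> ennreal (1 + \<theta>) * (ennreal ?S * ennreal ?S) + (ennreal (8 * c) * ennreal ((\<integral>z. u z \<partial>\<Omega>)\<^sup>2) + ennreal (2 * c))"
      unfolding e_def by (intro add_right_mono mult_left_mono mult_mono estimator_error A B k) simp_all
    also have "ennreal (1 + \<theta>) * (ennreal ?S * ennreal ?S) + (ennreal (8 * c) * ennreal ((\<integral>z. u z \<partial>\<Omega>)\<^sup>2) + ennreal (2 * c))
        = ennreal ((1 + \<theta>) * (?S * ?S) + (8 * c * (\<integral>z. u z \<partial>\<Omega>)\<^sup>2 + 2 * c))"
    proof -
      have "ennreal (1 + \<theta>) * (ennreal ?S * ennreal ?S) = ennreal ((1 + \<theta>) * (?S * ?S))"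
        using S \<open>\<theta> > 0\<close> by (simp only: ennreal_mult'[symmetric] mult_nonneg_nonneg)
      moreover have "ennreal (8 * c) * ennreal ((\<integral>z. u z \<partial>\<Omega>)\<^sup>2) = ennreal (8 * c * (\<integral>z. u z \<partial>\<Omega>)\<^sup>2)"
        using c by (intro ennreal_mult'[symmetric]) simp
      ultimately show ?thesis
        using S c \<open>\<theta> > 0\<close> by (simp only: ennreal_plus[symmetric] mult_nonneg_nonneg add_nonneg_nonneg
            zero_le_power2 zero_le_numeral zero_le_one less_imp_le)
    qed
    also have "(1 + \<theta>) * (?S * ?S) + (8 * c * (\<integral>z. u z \<partial>\<Omega>)\<^sup>2 + 2 * c) = (1 + \<theta>) * ?S\<^sup>2 + c * (8 * (\<integral>z. u z \<partial>\<Omega>)\<^sup>2 + 2)"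
      by (simp only: power2_eq_square distrib_left mult_ac)
    finally show ?thesis .
  qed
  show ?thesis
    unfolding mse_def
  proof (rule SUP_least)
    fix EA assume "EA \<in> {(Er, Av). Er \<subseteq> {..<N} \<and> Av \<subseteq> {..<N} \<and> card Er \<le> E \<and> card Av \<le> Ad}"
    then obtain Er Av where EA: "EA = (Er, Av)" "Er \<subseteq> {..<N}" "Av \<subseteq> {..<N}" "card Er \<le> E" "card Av \<le> Ad"
      by auto
    let ?f = "\<lambda>((a, b), (r, s)). SUP Y \<in> admissible_outputs N (fst EA) (snd EA) (\<lambda>i. (a + r i) * (b + s i)).
               ennreal ((d Y - a * b)\<^sup>2)"
    have "upper_nn_integral (distr M ((A \<Otimes>\<^sub>M B) \<Otimes>\<^sub>M (R \<Otimes>\<^sub>M R)) h) ?f \<le> (\<integral>\<^sup>+x. g x \<partial>M)"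
    proof (rule upper_nn_integral_distr_le[where k=h'])
      show "h \<in> measurable M ((A \<Otimes>\<^sub>M B) \<Otimes>\<^sub>M (R \<Otimes>\<^sub>M R))"
        unfolding h_def M_def by measurable
      show "h' \<in> measurable ((A \<Otimes>\<^sub>M B) \<Otimes>\<^sub>M (R \<Otimes>\<^sub>M R)) M"
        unfolding h'_def M_def by measurable
      show "h' (h x) = x" if "x \<in> space M" for x
        using that \<open>T < N\<close> \<open>s > 0\<close>
        by (auto simp: h_def h'_def M_def space_pair_measure \<Omega>_def space_PiM PiE_def recover_share_noise)
      have "Measurable.pred ((A \<Otimes>\<^sub>M B) \<Otimes>\<^sub>M (R \<Otimes>\<^sub>M R)) (\<lambda>y.
          share_noise N T s (recover_noise T s (fst (snd y))) = fst (snd y) \<and>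
          share_noise N T s (recover_noise T s (snd (snd y))) = snd (snd y))"
        by (intro pred_intros_logic measurable_compose[OF _ pr]) measurable
      then show "Measurable.pred ((A \<Otimes>\<^sub>M B) \<Otimes>\<^sub>M (R \<Otimes>\<^sub>M R)) (\<lambda>y. h (h' y) = y)"
        by (rule measurable_cong[THEN iffD1, rotated]) (auto simp: h_def h'_def)
      show "g \<in> borel_measurable M"
        unfolding g_def M_def case_prod_unfold by measurable
      fix x assume "x \<in> space M"
      obtain a b z w where x: "x = ((a, b), (z, w))"
        by (metis surj_pair)
      show "?f (h x) \<le> g x"
        unfolding x h_def prod.case
      proof (rule SUP_least)
        fix Y
        assume Y: "Y \<in> admissible_outputs N (fst EA) (snd EA) (\<lambda>i. (a + share_noise N T s z i) * (b + share_noise N T s w i))"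
        define \<rho> where "\<rho> = noise_size N T z * noise_size N T w"
        define E0 where "E0 = (a - k * (a + lead_noise T z)) * (b - k * (b + lead_noise T w))"
        define D where "D = d Y - (a * b - E0)"
        have "\<bar>D\<bar> \<le> K * (2 * \<rho> + 1)"
          unfolding D_def E0_def \<rho>_def
          by (rule d[OF EA(2-5) _ Y[unfolded EA(1) fst_conv snd_conv]]) (simp add: share_noise_def)
        then have "D\<^sup>2 \<le> (K * (2 * \<rho> + 1))\<^sup>2"
          using power_mono[of "\<bar>D\<bar>" _ 2] by simp
        \<comment> \<open>The difference
          \<open>8 * \<rho>\<^sup>2 + 2 - (2 * \<rho> + 1)\<^sup>2\<close> is
          \<open>(2 * \<rho> - 1)\<^sup>2\<close>. Removing the linear term leaves a bound in which
          \<open>\<rho>\<^sup>2\<close> factors over the two independent noises.\<close>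
        also have "\<dots> \<le> K\<^sup>2 * (8 * \<rho>\<^sup>2 + 2)"
          using zero_le_power2[of "2 * \<rho> - 1"]
          by (simp only: power_mult_distrib) (intro mult_left_mono, auto simp: power2_eq_square algebra_simps)
        finally have D2: "D\<^sup>2 \<le> K\<^sup>2 * (8 * \<rho>\<^sup>2 + 2)" .
        have "(d Y - a * b)\<^sup>2 = (- E0 + D)\<^sup>2"
          by (simp add: D_def)
        also have "\<dots> \<le> (1 + \<theta>) * (- E0)\<^sup>2 + (1 + 1 / \<theta>) * D\<^sup>2"
          by (rule square_add_le) fact
        also have "\<dots> \<le> (1 + \<theta>) * (- E0)\<^sup>2 + (1 + 1 / \<theta>) * (K\<^sup>2 * (8 * \<rho>\<^sup>2 + 2))"
          using \<open>\<theta> > 0\<close> D2 by (intro add_left_mono mult_left_mono) auto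
        also have "\<dots> = (1 + \<theta>) * (e a z * e b w) + (8 * c * (u z * u w) + 2 * c)"
        proof -
          have "(- E0)\<^sup>2 = e a z * e b w" "\<rho>\<^sup>2 = u z * u w"
            by (simp_all add: E0_def e_def u_def \<rho>_def power_mult_distrib)
          then show ?thesis
            by (simp add: c_def algebra_simps)
        qed
        finally have "ennreal ((d Y - a * b)\<^sup>2) \<le> ennreal ((1 + \<theta>) * (e a z * e b w) + (8 * c * (u z * u w) + 2 * c))"
          by (rule ennreal_leI)
        also have "\<dots> = g ((a, b), (z, w))"
          using c \<open>\<theta> > 0\<close> by (simp add: g_def ennreal_mult' ennreal_plus e_def u_def)
        finally show "ennreal ((d Y - a * b)\<^sup>2) \<le> g ((a, b), (z, w))" .
      qed
    qed
    also note int_g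
    finally show "upper_nn_integral ((A \<Otimes>\<^sub>M B) \<Otimes>\<^sub>M (share_law N s \<Otimes>\<^sub>M share_law N s)) ?f
      \<le> ennreal ((1 + \<theta>) * ?S\<^sup>2 + (1 + 1 / \<theta>) * K\<^sup>2 * (8 * (\<integral>z. (noise_size N T z)\<^sup>2 \<partial>\<Omega>)\<^sup>2 + 2))"
      unfolding law by (simp add: c_def u_def)
  qed
qed

end

section \<open>Choice of the parameters\<close>

theorem theorem2:
  fixes N T E Ad :: nat and \<eta> \<epsilon> :: real
  assumes "N \<ge> 1" and "N \<ge> T + E + 2 * Ad + 1" and "\<eta> \<ge> 0" and "\<epsilon> > 0"
  shows "\<forall>\<gamma> > 0. \<exists>PR PS (d :: obs \<Rightarrow> real).
           noise_law N PR \<and> noise_law N PS \<and>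
           node_dp N T \<epsilon> PR \<and> node_dp N T \<epsilon> PS \<and>
           (\<forall>muA muB. input_law \<eta> muA \<and> input_law \<eta> muB \<longrightarrow>
              mse N E Ad muA muB PR PS d
                \<le> ennreal (\<eta>\<^sup>2 / (1 + \<eta> / sigma_star_sq \<epsilon>)\<^sup>2 + \<gamma>))"
proof (intro allI impI)
  fix \<gamma> :: real
  assume "\<gamma> > 0"
  define \<sigma> where "\<sigma> = sigma_star_sq \<epsilon>"
  have "\<sigma> \<ge> 0"
    unfolding \<sigma>_def using assms(4) by (rule sigma_star_sq_nonneg)
  \<comment> \<open>If \<open>\<sigma> = 0\<close> then \<open>\<eta> / \<sigma> = 0\<close>, so \<open>\<kappa> = 1\<close> and the identity for \<open>\<kappa>\<close> below still holds.\<close>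
  define \<kappa> where "\<kappa> = 1 / (1 + \<eta> / \<sigma>)"
  have \<kappa>: "0 \<le> \<kappa>" "\<kappa> \<le> 1"
    using divide_nonneg_nonneg[OF assms(3) \<open>\<sigma> \<ge> 0\<close>] by (simp_all add: \<kappa>_def divide_le_eq_1)
  \<comment> \<open>The value of the linear estimation error at \<open>k = 1 - \<kappa>\<close>. The
    target of the theorem is the square of \<open>\<eta> * \<kappa>\<close>, one factor for each
    input.\<close>
  have \<kappa>_eq: "\<kappa>\<^sup>2 * \<eta> + (1 - \<kappa>)\<^sup>2 * \<sigma> = \<eta> * \<kappa>"
  proof (cases "\<sigma> = 0")
    case True
    then show ?thesis
      by (simp add: \<kappa>_def)
  next
    case False
    then have pos: "\<sigma> + \<eta> > 0"
      using \<open>\<sigma> \<ge> 0\<close> assms(3) by simp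
    have "\<kappa> = \<sigma> / (\<sigma> + \<eta>)"
      using False by (simp add: \<kappa>_def add_divide_eq_iff)
    then have "(\<sigma> + \<eta>) * \<kappa> = \<sigma>"
      using pos by simp
    then have "(1 - \<kappa>) * \<sigma> = \<kappa> * \<eta>"
      by (simp add: algebra_simps)
    then show ?thesis
      by (simp add: power2_eq_square mult.assoc) (simp add: algebra_simps)
  qed
  define G where "G = (\<eta> * \<kappa>)\<^sup>2"
  have G: "\<eta>\<^sup>2 / (1 + \<eta> / \<sigma>)\<^sup>2 = G"
    by (simp add: G_def \<kappa>_def power_divide)
  have "G \<ge> 0"
    by (simp add: G_def)
  \<comment> \<open>The excess variance: since \<open>\<delta>\<^sup>2 \<le> \<delta>\<close>, it
    raises \<open>(\<eta> * \<kappa>)\<^sup>2\<close> by at most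
    \<open>\<delta> * (2 * \<eta> * \<kappa> + 1)\<close>, the first third of
    \<open>\<gamma>\<close>.\<close>
  define \<delta> where "\<delta> = min 1 (\<gamma> / 3 / (2 * \<eta> * \<kappa> + 1))"
  have pos: "0 < 2 * \<eta> * \<kappa> + 1"
    using assms(3) \<kappa> by (simp add: add_nonneg_pos)
  then have \<delta>: "0 < \<delta>" "\<delta> \<le> 1"
    using \<open>\<gamma> > 0\<close> by (simp_all add: \<delta>_def)
  have "\<delta> \<le> \<gamma> / 3 / (2 * \<eta> * \<kappa> + 1)"
    by (simp only: \<delta>_def min.cobounded2)
  then have \<delta>_le: "\<delta> * (2 * \<eta> * \<kappa> + 1) \<le> \<gamma> / 3"
    unfolding pos_le_divide_eq[OF pos] .
  have "\<delta>\<^sup>2 \<le> \<delta>"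
    using \<delta> by (simp add: power2_eq_square mult_left_le)
  then have G\<delta>: "(\<eta> * \<kappa> + \<delta>)\<^sup>2 \<le> G + \<gamma> / 3"
    using \<delta>_le \<open>\<delta>\<^sup>2 \<le> \<delta>\<close> by (simp add: G_def power2_sum algebra_simps)
  obtain \<mu> C where \<mu>: "prob_space \<mu>" "sets \<mu> = sets borel" "integrable \<mu> (\<lambda>x. x\<^sup>2)"
      "(\<integral>x. x \<partial>\<mu>) = 0" "(\<integral>x. x\<^sup>2 \<partial>\<mu>) \<le> \<sigma> + \<delta>" "shift_bounded \<mu> C" "0 < C" "C < exp \<epsilon>"
    unfolding \<sigma>_def using near_optimal_noise[OF assms(4) \<delta>(1)] .
  interpret noise_space T \<mu>
    by (rule noise_space.intro) (fact \<mu>)+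
  \<comment> \<open>For \<open>\<sigma> > 0\<close> this is
    \<open>\<eta> / (\<sigma> + \<eta>)\<close>, the minimiser of
    \<open>(1 - k)\<^sup>2 * \<eta> + k\<^sup>2 * \<sigma>\<close>.\<close>
  define k where "k = 1 - \<kappa>"
  have k: "0 \<le> k" "k \<le> 1"
    using \<kappa> by (simp_all add: k_def)
  define S where "S = (1 - k)\<^sup>2 * \<eta> + k\<^sup>2 * (\<integral>x. x\<^sup>2 \<partial>\<mu>)"
  have "S \<le> \<eta> * \<kappa> + \<delta>"
  proof -
    have "S \<le> \<kappa>\<^sup>2 * \<eta> + (1 - \<kappa>)\<^sup>2 * (\<sigma> + \<delta>)"
      unfolding S_def k_def using \<mu>(5) by (simp add: mult_left_mono)
    also have "\<dots> = \<eta> * \<kappa> + (1 - \<kappa>)\<^sup>2 * \<delta>"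
      using \<kappa>_eq by (simp add: distrib_left)
    also have "(1 - \<kappa>)\<^sup>2 * \<delta> \<le> 1 * \<delta>"
      using \<kappa> \<delta>(1) by (intro mult_right_mono power_le_one) auto
    finally show ?thesis
      by simp
  qed
  moreover have "S \<ge> 0"
    unfolding S_def using assms(3) by simp
  ultimately have S2: "S\<^sup>2 \<le> G + \<gamma> / 3"
    using G\<delta> power_mono[of S "\<eta> * \<kappa> + \<delta>" 2] by linarith
  \<comment> \<open>Chosen so that \<open>(1 + \<theta>) * (G + \<gamma> / 3)\<close> is exactly
    \<open>G + 2 * \<gamma> / 3\<close>, the second third of \<open>\<gamma>\<close>.\<close>
  define \<theta> where "\<theta> = \<gamma> / 3 / (G + \<gamma> / 3)"
  have "\<theta> > 0"
    using \<open>\<gamma> > 0\<close> \<open>G \<ge> 0\<close> by (simp add: \<theta>_def add_nonneg_pos)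
  have "(1 + \<theta>) * S\<^sup>2 \<le> (1 + \<theta>) * (G + \<gamma> / 3)"
    using S2 \<open>\<theta> > 0\<close> by (intro mult_left_mono) auto
  also have "\<dots> = G + 2 * \<gamma> / 3"
    using \<open>\<gamma> > 0\<close> \<open>G \<ge> 0\<close> by (simp add: \<theta>_def add_nonneg_eq_0_iff field_simps)
  finally have main: "(1 + \<theta>) * S\<^sup>2 \<le> G + 2 * \<gamma> / 3" .
  obtain K1 where K1: "\<And>TT s. TT \<subseteq> {..<N} \<Longrightarrow> card TT = T \<Longrightarrow> 0 < s \<Longrightarrow> s \<le> 1 \<Longrightarrow>
     \<exists>w. \<bar>w 0\<bar> \<le> 1 \<and> (\<Sum>j=1..<T. \<bar>w j\<bar>) \<le> K1 * s \<and> (\<forall>i\<in>TT. poly (noise_poly T s w) (real i) = 1)"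
    using unit_shift[of N T] by blast
  obtain K2 where "K2 \<ge> 0" and K2: "\<And>s k. 0 < s \<Longrightarrow> s \<le> 1 \<Longrightarrow> 0 \<le> k \<Longrightarrow> k \<le> 1 \<Longrightarrow>
      \<exists>d :: obs \<Rightarrow> real. \<forall>Er Av Y a b z w c. Er \<subseteq> {..<N} \<longrightarrow> Av \<subseteq> {..<N} \<longrightarrow> card Er \<le> E \<longrightarrow> card Av \<le> Ad \<longrightarrow>
       (\<forall>i<N. c i = (a + poly (noise_poly T s z) (real i)) * (b + poly (noise_poly T s w) (real i))) \<longrightarrow>
       Y \<in> admissible_outputs N Er Av c \<longrightarrow>
       \<bar>d Y - (a * b - (a - k * (a + lead_noise T z)) * (b - k * (b + lead_noise T w)))\<bar>
         \<le> K2 * s * (2 * (noise_size N T z * noise_size N T w) + 1)"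
    using decoder_exists[OF assms(2)] by metis
  \<comment> \<open>The remainder is \<open>L * s\<^sup>2\<close>. Since \<open>L\<close>,
    \<open>C\<close> and \<open>K1\<close> do not depend on \<open>s\<close>, a small
    \<open>s\<close> meets both the last third of \<open>\<gamma>\<close> and the privacy
    budget.\<close>
  define L where "L = (1 + 1 / \<theta>) * K2\<^sup>2 * (8 * (\<integral>z. (noise_size N T z)\<^sup>2 \<partial>\<Omega>)\<^sup>2 + 2)"
  have "((\<lambda>s. L * s\<^sup>2) \<longlongrightarrow> L * 0\<^sup>2) (at_right 0)"
    by (intro tendsto_intros)
  then have "\<forall>\<^sub>F s in at_right 0. L * s\<^sup>2 < \<gamma> / 3"
    by (rule order_tendstoD(2)) (use \<open>\<gamma> > 0\<close> in simp)
  moreover have "((\<lambda>s. C * exp (K1 * s)) \<longlongrightarrow> C * exp (K1 * 0)) (at_right 0)"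
    by (intro tendsto_intros)
  then have "\<forall>\<^sub>F s in at_right 0. C * exp (K1 * s) < exp \<epsilon>"
    by (rule order_tendstoD(2)) (use \<mu>(8) in simp)
  moreover have "\<forall>\<^sub>F s in at_right 0. 0 < s \<and> s < (1 :: real)"
    by (rule eventually_at_rightI[of 0 1]) simp_all
  ultimately have "\<forall>\<^sub>F s in at_right 0. L * s\<^sup>2 < \<gamma> / 3 \<and> C * exp (K1 * s) < exp \<epsilon> \<and> 0 < s \<and> s < 1"
    by eventually_elim auto
  then obtain s where s: "L * s\<^sup>2 < \<gamma> / 3" "C * exp (K1 * s) < exp \<epsilon>" "0 < s" "s < 1"
    using eventually_happens'[OF trivial_limit_at_right_real] by blast
  obtain d :: "obs \<Rightarrow> real" where d: "\<And>Er Av Y a b z w c. Er \<subseteq> {..<N} \<Longrightarrow> Av \<subseteq> {..<N} \<Longrightarrow> card Er \<le> E \<Longrightarrow> card Av \<le> Ad \<Longrightarrow>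
       (\<And>i. i < N \<Longrightarrow> c i = (a + poly (noise_poly T s z) (real i)) * (b + poly (noise_poly T s w) (real i))) \<Longrightarrow>
       Y \<in> admissible_outputs N Er Av c \<Longrightarrow>
       \<bar>d Y - (a * b - (a - k * (a + lead_noise T z)) * (b - k * (b + lead_noise T w)))\<bar>
         \<le> K2 * s * (2 * (noise_size N T z * noise_size N T w) + 1)"
    using K2[OF s(3) less_imp_le[OF s(4)] k] by metis
  have "T < N"
    using assms(2) by simp
  have dp: "node_dp N T \<epsilon> (share_law N s)"
    using K1[OF _ _ s(3) less_imp_le[OF s(4)]] \<mu>(7) assms(4) s(2)
    by (intro node_dp_share_law[OF \<mu>(6)]) auto
  \<comment> \<open>Noise and decoder are fixed at this point, so one scheme serves all input laws;
    only \<open>\<eta>\<close> entered its construction.\<close>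
  have "mse N E Ad muA muB (share_law N s) (share_law N s) d \<le> ennreal (G + \<gamma>)"
    if "input_law \<eta> muA" "input_law \<eta> muB" for muA muB
  proof -
    have "mse N E Ad muA muB (share_law N s) (share_law N s) d
        \<le> ennreal ((1 + \<theta>) * ((1 - k)\<^sup>2 * \<eta> + k\<^sup>2 * (\<integral>x. x\<^sup>2 \<partial>\<mu>))\<^sup>2
          + (1 + 1 / \<theta>) * (K2 * s)\<^sup>2 * (8 * (\<integral>z. (noise_size N T z)\<^sup>2 \<partial>\<Omega>)\<^sup>2 + 2))"
      using \<open>K2 \<ge> 0\<close> s(3)
      by (intro mse_share_law[OF \<open>T < N\<close> s(3) _ \<open>\<theta> > 0\<close> k that assms(3) d]) simp_all
    also have "\<dots> = ennreal ((1 + \<theta>) * S\<^sup>2 + L * s\<^sup>2)"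
      by (simp add: S_def L_def power_mult_distrib mult_ac)
    also have "\<dots> \<le> ennreal (G + \<gamma>)"
      using main s(1) by (intro ennreal_leI) simp
    finally show ?thesis .
  qed
  then show "\<exists>PR PS (d :: obs \<Rightarrow> real).
           noise_law N PR \<and> noise_law N PS \<and>
           node_dp N T \<epsilon> PR \<and> node_dp N T \<epsilon> PS \<and>
           (\<forall>muA muB. input_law \<eta> muA \<and> input_law \<eta> muB \<longrightarrow>
              mse N E Ad muA muB PR PS d
                \<le> ennreal (\<eta>\<^sup>2 / (1 + \<eta> / sigma_star_sq \<epsilon>)\<^sup>2 + \<gamma>))"
    unfolding \<sigma>_def[symmetric] G using noise_law_share_law[of N s] dp by blast
qed

end
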